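(* Let $D$, $n_1$, $\eta$ be as in the context. If $n_1-1$ is uniformly positive (or uniformly negative) in $D$, i.e. there is $c>0$ with $n_1-1\ge c$ a.e. or $n_1-1\le -c$ a.e. in $D$, then for every $k\in\mathbb{C}$ with $\mathrm{Re}(k)>0$ the operator $\mathbb{B}_{n_2,k}$ converges in operator norm to $\mathbb{B}_{0,k}$ as $n_2\to0$ in $L^\infty(D)$.
   Context: Let $d\in\{2,3\}$ and let $D\subset\mathbb{R}^d$ be a bounded simply connected open set with $\mathcal{C}^2$ boundary and unit outward normal $\nu$. $n_1\in L^\infty(D)$ is real-valued and positive; $n_2\in L^\infty(D)$ is real-valued and nonnegative (absorption); $\eta\in L^\infty(\partial D)$ is a fixed real-valued positive conductivity with $1/\eta\in L^\infty(\partial D)$. $X=H^2(D)\cap H^1_0(D)=\{u\in H^2(D):u=0\text{ on }\partial D\}$ with the $H^2(D)$ inner product. For $\mathrm{Re}(k)>0$, the bounded linear operator $\mathbb{B}_{n_2,k}:X\to X$ is defined via the Riesz representation theorem by $$(\mathbb{B}_{n_2,k}u,\varphi)_{H^2(D)}=\int_{\partial D}\frac1\eta\frac{\partial u}{\partial\nu}\frac{\partial\overline\varphi}{\partial\nu}\,ds-\int_D\nabla u\cdot\nabla\overline\varphi\,dx+k^2\int_D\frac{kn_1+\mathrm{i}n_2}{k(n_1-1)+\mathrm{i}n_2}u\overline\varphi\,dx+k\int_D\frac{1}{k(n_1-1)+\mathrm{i}n_2}(\overline\varphi\,\Delta u+u\,\Delta\overline\varphi)\,dx$$ for all $\varphi\in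 X$; $\mathbb{B}_{0,k}$ is the operator with $n_2=0$. *)

theory Defs
  imports "HOL-Probability.Essential_Supremum" "HOL-Analysis.Analysis"
begin

text \<open>
  Elements of \<open>L\<^sup>2\<close> and Sobolev spaces are represented by functions, and two representatives that
  agree almost everywhere on the domain stand for the same element. Objects that are unique only up
  to null sets (weak derivatives, traces, Riesz representatives) are picked by \<open>SOME\<close> from a
  predicate that is invariant under changing representatives.
\<close>

section \<open>Differentiability classes and domains\<close>

primrec Ck :: "nat \<Rightarrow> ('a::euclidean_space \<Rightarrow> 'b::real_normed_vector) \<Rightarrow> bool" where
  "Ck 0 f \<longleftrightarrow> continuous_on UNIV f"
| "Ck (Suc m) f \<longleftrightarrow>
     (\<forall>x. f differentiable (at x)) \<and> (\<forall>v. Ck m (\<lambda>x. frechet_derivative f (at x) v))"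

definition smooth :: "('a::euclidean_space \<Rightarrow> 'b::real_normed_vector) \<Rightarrow> bool" where
  "smooth f \<longleftrightarrow> (\<forall>m. Ck m f)"

text \<open>
  Near \<open>x0\<close> the set \<open>D\<close> is the region above the graph, in the direction of the unit vector \<open>e\<close>, of
  a \<open>C\<^sup>2\<close> function of the remaining coordinates. A function of the coordinates orthogonal to \<open>e\<close> is
  encoded as a function on the whole space that is invariant under translation along \<open>e\<close>.
\<close>

definition C2_graph_chart ::
  "'a::euclidean_space set \<Rightarrow> 'a \<Rightarrow> real \<Rightarrow> 'a \<Rightarrow> ('a \<Rightarrow> real) \<Rightarrow> bool" where
  "C2_graph_chart D x0 r e \<gamma> \<longleftrightarrow>
     r > 0 \<and> norm e = 1 \<and> Ck 2 \<gamma> \<and> (\<forall>y t. \<gamma> (y + t *\<^sub>R e) = \<gamma> y) \<and>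
     D \<inter> ball x0 r = {y \<in> ball x0 r. y \<bullet> e > \<gamma> y}"

definition C2_boundary :: "'a::euclidean_space set \<Rightarrow> bool" where
  "C2_boundary D \<longleftrightarrow> (\<forall>x0\<in>frontier D. \<exists>r e \<gamma>. C2_graph_chart D x0 r e \<gamma>)"

text \<open>
  In a chart, \<open>D\<close> is locally the sublevel set \<open>\<gamma> y - y \<bullet> e < 0\<close>, so the outward normal is the
  normalised gradient of that function.
\<close>

definition outward_normal :: "'a::euclidean_space set \<Rightarrow> 'a \<Rightarrow> 'a" where
  "outward_normal D x =
     (SOME \<nu>. \<exists>r e \<gamma> v. C2_graph_chart D x r e \<gamma> \<and> (\<gamma> has_derivative (\<lambda>h. v \<bullet> h)) (at x) \<and>
                \<nu> = (v - e) /\<^sub>R norm (v - e))"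

section \<open>Surface measure\<close>

text \<open>
  The surface measure of the boundary is the Hausdorff measure of dimension \<open>d - 1\<close>, normalised so
  that it agrees with Lebesgue measure on hyperplanes. The restriction to bounded covering sets is
  needed because \<open>diameter\<close> is unspecified on unbounded sets.
\<close>

definition hausdorff_content :: "real \<Rightarrow> real \<Rightarrow> 'a::metric_space set \<Rightarrow> ennreal" where
  "hausdorff_content s \<delta> A =
     (INF U \<in> {U :: nat \<Rightarrow> 'a set. A \<subseteq> (\<Union>i. U i) \<and> (\<forall>i. bounded (U i) \<and> diameter (U i) \<le> \<delta>)}.
        \<Sum>i. ennreal (unit_ball_vol s * (diameter (U i) / 2) powr s))"

definition hausdorff_measure :: "real \<Rightarrow> 'a::metric_space measure" where
  "hausdorff_measure s = measure_of UNIV (sets borel) (\<lambda>A. SUP \<delta>\<in>{0<..}. hausdorff_content s \<delta> A)"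

definition surface_measure :: "'a::euclidean_space set \<Rightarrow> 'a measure" where
  "surface_measure D =
     completion (restrict_space (hausdorff_measure (real DIM('a) - 1)) (frontier D))"

section \<open>Lebesgue and Sobolev spaces\<close>

definition Linf_norm :: "'a measure \<Rightarrow> ('a \<Rightarrow> real) \<Rightarrow> ereal" where
  "Linf_norm M f = esssup M (\<lambda>x. ereal \<bar>f x\<bar>)"

definition Linf :: "'a measure \<Rightarrow> ('a \<Rightarrow> real) set" where
  "Linf M = {f \<in> borel_measurable M. Linf_norm M f < \<infinity>}"

definition L2 :: "'a measure \<Rightarrow> ('a \<Rightarrow> complex) set" where
  "L2 M = {f \<in> borel_measurable M. integrable M (\<lambda>x. (norm (f x))\<^sup>2)}"

definition L2_inner :: "'a measure \<Rightarrow> ('a \<Rightarrow> complex) \<Rightarrow> ('a \<Rightarrow> complex) \<Rightarrow> complex" where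
  "L2_inner M f g = (\<integral>x. f x * cnj (g x) \<partial>M)"

definition test_function :: "'a::euclidean_space set \<Rightarrow> ('a \<Rightarrow> complex) \<Rightarrow> bool" where
  "test_function D \<phi> \<longleftrightarrow> smooth \<phi> \<and> compact (closure {x. \<phi> x \<noteq> 0}) \<and> closure {x. \<phi> x \<noteq> 0} \<subseteq> D"

definition is_weak_partial ::
  "'a::euclidean_space set \<Rightarrow> 'a \<Rightarrow> ('a \<Rightarrow> complex) \<Rightarrow> ('a \<Rightarrow> complex) \<Rightarrow> bool" where
  "is_weak_partial D b u v \<longleftrightarrow>
     u \<in> L2 (lebesgue_on D) \<and> v \<in> L2 (lebesgue_on D) \<and>
     (\<forall>\<phi>. test_function D \<phi> \<longrightarrow>
        (\<integral>x. u x * frechet_derivative \<phi> (at x) b \<partial>lebesgue_on D) =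
        - (\<integral>x. v x * \<phi> x \<partial>lebesgue_on D))"

definition weak_partial ::
  "'a::euclidean_space set \<Rightarrow> 'a \<Rightarrow> ('a \<Rightarrow> complex) \<Rightarrow> 'a \<Rightarrow> complex" where
  "weak_partial D b u = (SOME v. is_weak_partial D b u v)"

definition H1 :: "'a::euclidean_space set \<Rightarrow> ('a \<Rightarrow> complex) set" where
  "H1 D = {u \<in> L2 (lebesgue_on D). \<forall>b\<in>Basis. \<exists>v. is_weak_partial D b u v}"

definition H1_inner ::
  "'a::euclidean_space set \<Rightarrow> ('a \<Rightarrow> complex) \<Rightarrow> ('a \<Rightarrow> complex) \<Rightarrow> complex" where
  "H1_inner D u v = L2_inner (lebesgue_on D) u v +
     (\<Sum>b\<in>Basis. L2_inner (lebesgue_on D) (weak_partial D b u) (weak_partial D b v))"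

definition H1_norm :: "'a::euclidean_space set \<Rightarrow> ('a \<Rightarrow> complex) \<Rightarrow> real" where
  "H1_norm D u = sqrt (Re (H1_inner D u u))"

definition H1_0 :: "'a::euclidean_space set \<Rightarrow> ('a \<Rightarrow> complex) set" where
  "H1_0 D = {u \<in> H1 D. \<exists>\<phi>. (\<forall>m. test_function D (\<phi> m)) \<and>
                           (\<lambda>m. H1_norm D (\<lambda>x. \<phi> m x - u x)) \<longlonglongrightarrow> 0}"

definition H2 :: "'a::euclidean_space set \<Rightarrow> ('a \<Rightarrow> complex) set" where
  "H2 D = {u \<in> H1 D. \<forall>b\<in>Basis. weak_partial D b u \<in> H1 D}"

definition H2_inner ::
  "'a::euclidean_space set \<Rightarrow> ('a \<Rightarrow> complex) \<Rightarrow> ('a \<Rightarrow> complex) \<Rightarrow> complex" where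
  "H2_inner D u v = H1_inner D u v +
     (\<Sum>b\<in>Basis. \<Sum>c\<in>Basis. L2_inner (lebesgue_on D)
        (weak_partial D c (weak_partial D b u)) (weak_partial D c (weak_partial D b v)))"

definition H2_norm :: "'a::euclidean_space set \<Rightarrow> ('a \<Rightarrow> complex) \<Rightarrow> real" where
  "H2_norm D u = sqrt (Re (H2_inner D u u))"

definition laplacian :: "'a::euclidean_space set \<Rightarrow> ('a \<Rightarrow> complex) \<Rightarrow> 'a \<Rightarrow> complex" where
  "laplacian D u x = (\<Sum>b\<in>Basis. weak_partial D b (weak_partial D b u) x)"

text \<open>
  The trace is the continuous extension to \<open>H\<^sup>1(D)\<close> of the restriction of smooth functions to the
  boundary.
\<close>

definition is_trace ::
  "'a::euclidean_space set \<Rightarrow> ('a \<Rightarrow> complex) \<Rightarrow> ('a \<Rightarrow> complex) \<Rightarrow> bool" where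
  "is_trace D w g \<longleftrightarrow> w \<in> H1 D \<and> g \<in> L2 (surface_measure D) \<and>
     (\<exists>f. (\<forall>m. smooth (f m)) \<and>
          (\<lambda>m. H1_norm D (\<lambda>x. f m x - w x)) \<longlonglongrightarrow> 0 \<and>
          (\<lambda>m. \<integral>x. (norm (f m x - g x))\<^sup>2 \<partial>surface_measure D) \<longlonglongrightarrow> 0)"

definition trace_of :: "'a::euclidean_space set \<Rightarrow> ('a \<Rightarrow> complex) \<Rightarrow> 'a \<Rightarrow> complex" where
  "trace_of D w = (SOME g. is_trace D w g)"

definition normal_derivative ::
  "'a::euclidean_space set \<Rightarrow> ('a \<Rightarrow> complex) \<Rightarrow> 'a \<Rightarrow> complex" where
  "normal_derivative D u x =
     (\<Sum>b\<in>Basis. complex_of_real (outward_normal D x \<bullet> b) * trace_of D (weak_partial D b u) x)"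

section \<open>The operator\<close>

definition X_space :: "'a::euclidean_space set \<Rightarrow> ('a \<Rightarrow> complex) set" where
  "X_space D = H2 D \<inter> H1_0 D"

definition B_form ::
  "'a::euclidean_space set \<Rightarrow> ('a \<Rightarrow> real) \<Rightarrow> ('a \<Rightarrow> real) \<Rightarrow> ('a \<Rightarrow> real) \<Rightarrow> complex \<Rightarrow>
   ('a \<Rightarrow> complex) \<Rightarrow> ('a \<Rightarrow> complex) \<Rightarrow> complex" where
  "B_form D \<eta> n1 n2 k u \<phi> =
     (\<integral>x. complex_of_real (1 / \<eta> x) * normal_derivative D u x * cnj (normal_derivative D \<phi> x)
        \<partial>surface_measure D)
     - (\<integral>x. (\<Sum>b\<in>Basis. weak_partial D b u x * cnj (weak_partial D b \<phi> x)) \<partial>lebesgue_on D)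
     + k\<^sup>2 * (\<integral>x. (k * complex_of_real (n1 x) + \<i> * complex_of_real (n2 x)) /
                   (k * complex_of_real (n1 x - 1) + \<i> * complex_of_real (n2 x)) *
                   u x * cnj (\<phi> x) \<partial>lebesgue_on D)
     + k * (\<integral>x. 1 / (k * complex_of_real (n1 x - 1) + \<i> * complex_of_real (n2 x)) *
                  (cnj (\<phi> x) * laplacian D u x + u x * cnj (laplacian D \<phi> x)) \<partial>lebesgue_on D)"

definition B_op ::
  "'a::euclidean_space set \<Rightarrow> ('a \<Rightarrow> real) \<Rightarrow> ('a \<Rightarrow> real) \<Rightarrow> ('a \<Rightarrow> real) \<Rightarrow> complex \<Rightarrow>
   ('a \<Rightarrow> complex) \<Rightarrow> 'a \<Rightarrow> complex" where
  "B_op D \<eta> n1 n2 k u =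
     (SOME w. w \<in> X_space D \<and> (\<forall>\<phi>\<in>X_space D. H2_inner D w \<phi> = B_form D \<eta> n1 n2 k u \<phi>))"

definition X_op_norm ::
  "'a::euclidean_space set \<Rightarrow> (('a \<Rightarrow> complex) \<Rightarrow> 'a \<Rightarrow> complex) \<Rightarrow> ereal" where
  "X_op_norm D T = (SUP u \<in> {u \<in> X_space D. H2_norm D u \<le> 1}. ereal (H2_norm D (T u)))"

end

theory Submission
  imports Defs
begin

text \<open>
  The forms defining the two operators differ only by volume integrals with the multiplier
  \<open>1 / (k (n\<^sub>1 - 1) + \<i> n\<^sub>2) - 1 / (k (n\<^sub>1 - 1))\<close>, since
  \<open>(k n\<^sub>1 + \<i> n\<^sub>2) / (k (n\<^sub>1 - 1) + \<i> n\<^sub>2) = 1 + k / (k (n\<^sub>1 - 1) + \<i> n\<^sub>2)\<close>. The real parts of both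
  denominators are at least \<open>c Re k\<close> in modulus, so the multiplier is
  \<open>O(\<parallel>n\<^sub>2\<parallel>\<^sub>\<infinity>)\<close> and the difference of the forms is bounded on \<open>X \<times> X\<close> by
  a multiple of \<open>\<parallel>n\<^sub>2\<parallel>\<^sub>\<infinity>\<close>. The boundary term cancels. No trace theorem is needed even for the
  existence of the Riesz representatives: the difference of the forms is representable because
  \<open>X\<close> is complete, so one form is representable exactly when the other is, and if neither is then
  the two arbitrary choices coincide.
\<close>

section \<open>Functions of class \<open>C\<^sup>k\<close> and bump functions\<close>

lemma Ck_imp_continuous: "Ck m f \<Longrightarrow> continuous_on UNIV f"
  by (cases m) (auto simp: continuous_on_eq_continuous_at differentiable_imp_continuous_within)

lemma Ck_SucD: "Ck (Suc m) f \<Longrightarrow> Ck m f"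
proof (induction m arbitrary: f)
  case 0
  then show ?case using Ck_imp_continuous Ck.simps(1) by blast
next
  case (Suc m)
  then show ?case by (metis Ck.simps(2))
qed

lemma Ck_SucI:
  assumes "\<And>x. (f has_derivative f' x) (at x)" "\<And>v. Ck m (\<lambda>x. f' x v)"
  shows "Ck (Suc m) f"
proof -
  have "frechet_derivative f (at x) = f' x" for x
    using frechet_derivative_at[OF assms(1)] by simp
  then show ?thesis
    using assms by (auto simp: differentiable_def)
qed

lemma Ck_const: "Ck m (\<lambda>x. c)"
  by (induction m arbitrary: c) (auto intro!: Ck_SucI[where f' = "\<lambda>_ _. 0"])

lemma Ck_bounded_linear:
  assumes L: "bounded_linear L"
  shows "Ck m f \<Longrightarrow> Ck m (\<lambda>x. L (f x))"
proof (induction m arbitrary: f)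
  case 0
  then show ?case using L by (auto intro: bounded_linear.continuous_on)
next
  case (Suc m)
  show ?case
  proof (rule Ck_SucI)
    show "((\<lambda>x. L (f x)) has_derivative (\<lambda>v. L (frechet_derivative f (at x) v))) (at x)" for x
      using Suc.prems by (intro bounded_linear.has_derivative[OF L]) (simp add: frechet_derivative_works[symmetric])
  qed (use Suc in auto)
qed

lemma Ck_add:
  "Ck m f \<Longrightarrow> Ck m g \<Longrightarrow> Ck m (\<lambda>x. f x + g x)"
proof (induction m arbitrary: f g)
  case 0
  then show ?case by (auto intro: continuous_on_add)
next
  case (Suc m)
  show ?case
  proof (rule Ck_SucI)
    show "((\<lambda>x. f x + g x) has_derivative
      (\<lambda>v. frechet_derivative f (at x) v + frechet_derivative g (at x) v)) (at x)" for x
      using Suc.prems by (intro has_derivative_add) (simp_all add: frechet_derivative_works[symmetric])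
  qed (use Suc in auto)
qed

lemma Ck_mult:
  fixes f g :: "'a::euclidean_space \<Rightarrow> 'b::real_normed_algebra"
  shows "Ck m f \<Longrightarrow> Ck m g \<Longrightarrow> Ck m (\<lambda>x. f x * g x)"
proof (induction m arbitrary: f g)
  case 0
  then show ?case by (auto intro: continuous_on_mult)
next
  case (Suc m)
  show ?case
  proof (rule Ck_SucI)
    show "((\<lambda>x. f x * g x) has_derivative
      (\<lambda>v. f x * frechet_derivative g (at x) v + frechet_derivative f (at x) v * g x)) (at x)" for x
      using Suc.prems by (intro has_derivative_mult) (simp_all add: frechet_derivative_works[symmetric])
    show "Ck m (\<lambda>x. f x * frechet_derivative g (at x) v + frechet_derivative f (at x) v * g x)" for v
      using Suc.prems Ck_SucD[OF Suc.prems(1)] Ck_SucD[OF Suc.prems(2)]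
      by (intro Ck_add Suc.IH) auto
  qed
qed

lemma Ck_prod:
  fixes f :: "'i \<Rightarrow> 'a::euclidean_space \<Rightarrow> 'b::{real_normed_algebra_1, comm_monoid_mult}"
  shows "(\<And>i. i \<in> I \<Longrightarrow> Ck m (f i)) \<Longrightarrow> Ck m (\<lambda>x. \<Prod>i\<in>I. f i x)"
  by (induction I rule: infinite_finite_induct) (auto intro!: Ck_mult simp: Ck_const)

text \<open>Every derivative of the function \<open>exp (- 1 / t)\<close> is of this form.\<close>

definition flat :: "real poly \<Rightarrow> real \<Rightarrow> real" where
  "flat p t = (if t > 0 then poly p (1 / t) * exp (- (1 / t)) else 0)"

lemma poly_times_exp_minus_tendsto_0: "((\<lambda>s::real. poly p s * exp (- s)) \<longlongrightarrow> 0) at_top"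
proof -
  have "((\<lambda>s::real. \<Sum>i\<le>degree p. coeff p i * (s ^ i / exp s)) \<longlongrightarrow> (\<Sum>i\<le>degree p. coeff p i * 0)) at_top"
    by (intro tendsto_intros tendsto_power_div_exp_0)
  then show ?thesis
    by (simp add: poly_altdef exp_minus sum_distrib_right divide_inverse mult.assoc)
qed

lemma flat_tendsto_0: "(flat p \<longlongrightarrow> 0) (at 0)"
proof (rule filterlim_split_at)
  show "(flat p \<longlongrightarrow> 0) (at_left 0)"
    by (rule tendsto_eventually) (auto simp: flat_def eventually_at_filter)
  have "((\<lambda>t. poly p (inverse t) * exp (- inverse t)) \<longlongrightarrow> 0) (at_right 0)"
    by (rule filterlim_compose[OF poly_times_exp_minus_tendsto_0 filterlim_inverse_at_top_right])
  then show "(flat p \<longlongrightarrow> 0) (at_right 0)"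
    by (rule Lim_transform_eventually) (auto simp: flat_def eventually_at_filter field_simps)
qed

definition flat_deriv :: "real poly \<Rightarrow> real poly" where
  "flat_deriv p = monom 1 2 * (p - pderiv p)"

lemma flat_has_real_derivative: "(flat p has_real_derivative flat (flat_deriv p) t) (at t)"
proof (cases t "0::real" rule: linorder_cases)
  case less
  have "((\<lambda>_. 0) has_real_derivative 0) (at t)" by simp
  then have "(flat p has_real_derivative 0) (at t)"
    by (rule has_field_derivative_transform_within_open[where S = "{..<0}"]) (use less in \<open>auto simp: flat_def\<close>)
  then show ?thesis using less by (simp add: flat_def)
next
  case equal
  have "((\<lambda>h. flat (monom 1 1 * p) h) \<longlongrightarrow> 0) (at 0)" by (rule flat_tendsto_0)
  moreover have "flat (monom 1 1 * p) h = (flat p (0 + h) - flat p 0) / h" for h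
    by (simp add: flat_def poly_monom)
  ultimately show ?thesis
    using equal by (simp add: DERIV_def flat_def)
next
  case greater
  have "((\<lambda>t. poly p (1 / t) * exp (- (1 / t))) has_real_derivative flat (flat_deriv p) t) (at t)"
    using greater
    by (auto intro!: derivative_eq_intros DERIV_chain2[OF poly_DERIV]
        simp: flat_def flat_deriv_def poly_monom field_simps power2_eq_square)
  then show ?thesis
    by (rule has_field_derivative_transform_within_open[where S = "{0<..}"])
      (use greater in \<open>auto simp: flat_def\<close>)
qed

lemma Ck_flat: "Ck m (\<lambda>x::'a::euclidean_space. flat p (c * (x \<bullet> b) + d))"
proof (induction m arbitrary: p)
  have der: "((\<lambda>x. flat p (c * (x \<bullet> b) + d)) has_derivative
      (\<lambda>v. c * (v \<bullet> b) * flat (flat_deriv p) (c * (x \<bullet> b) + d))) (at x)" for x :: 'a and p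
  proof -
    have "((\<lambda>x. c * (x \<bullet> b) + d) has_derivative (\<lambda>v. c * (v \<bullet> b))) (at x)"
      by (auto intro!: derivative_eq_intros)
    from has_derivative_compose[OF this, of "flat p"] flat_has_real_derivative show ?thesis
      by (fastforce simp: has_field_derivative_def mult.commute)
  qed
  {
    case 0
    show ?case
      unfolding Ck.simps by (rule has_derivative_continuous_on) (rule has_derivative_at_withinI[OF der])
  next
    case (Suc m)
    show ?case
      by (rule Ck_SucI[OF der]) (intro Ck_mult Ck_const Suc)
  }
qed

text \<open>Smooth, positive exactly on \<open>box a b\<close>, and increasing to its indicator as \<open>m\<close> grows.\<close>

definition bump :: "'a::euclidean_space \<Rightarrow> 'a \<Rightarrow> nat \<Rightarrow> 'a \<Rightarrow> complex" where
  "bump a b m x = complex_of_real (\<Prod>i\<in>Basis.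
     flat 1 (real (Suc m) * (x \<bullet> i) + - (real (Suc m) * (a \<bullet> i))) *
     flat 1 (- real (Suc m) * (x \<bullet> i) + real (Suc m) * (b \<bullet> i)))"

lemma smooth_bump: "smooth (bump a b m)"
  unfolding smooth_def bump_def
  by (intro allI Ck_bounded_linear[OF bounded_linear_of_real] Ck_prod Ck_mult Ck_flat)

lemma flat_1: "flat 1 t = (if t > 0 then exp (- (1 / t)) else 0)"
  by (simp add: flat_def)

lemma bump_arg: "c * y + - (c * z) = c * (y - z)" "- c * y + c * z = c * (z - y)" for c y z :: real
  by (simp_all add: algebra_simps)

lemma flat_1_bounds: "0 \<le> flat 1 t" "flat 1 t \<le> 1"
  by (auto simp: flat_1)

lemma bump_eq_0:
  assumes "x \<notin> box a b" shows "bump a b m x = 0"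
proof -
  obtain i where "i \<in> Basis" "x \<bullet> i \<le> a \<bullet> i \<or> b \<bullet> i \<le> x \<bullet> i"
    using assms by (force simp: mem_box)
  then show ?thesis
    unfolding bump_def bump_arg
    by (auto simp: flat_1 zero_less_mult_iff intro!: bexI[of _ i])
qed

lemma norm_bump_le_1: "norm (bump a b m x) \<le> 1"
  unfolding bump_def norm_of_real
  by (auto simp: abs_prod abs_mult flat_1_bounds intro!: prod_le_1 mult_le_one)

lemma flat_1_scale_tendsto:
  assumes "t > 0" shows "(\<lambda>m. flat 1 (real (Suc m) * t)) \<longlonglongrightarrow> 1"
proof -
  have "(\<lambda>m. exp (- (1 / real (Suc m) * (1 / t)))) \<longlonglongrightarrow> exp (- (0 * (1 / t)))"
    by (intro tendsto_intros LIMSEQ_Suc lim_1_over_n)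
  then show ?thesis using assms by (simp add: flat_1 del: of_nat_Suc)
qed

lemma bump_tendsto: "(\<lambda>m. bump a b m x) \<longlonglongrightarrow> indicator (box a b) x"
proof (cases "x \<in> box a b")
  case True
  have "(\<lambda>m. bump a b m x) \<longlonglongrightarrow> complex_of_real (\<Prod>i\<in>(Basis::'a set). 1 * 1)"
    unfolding bump_def bump_arg
    by (intro tendsto_intros flat_1_scale_tendsto) (use True in \<open>auto simp: mem_box\<close>)
  then show ?thesis using True by simp
qed (simp add: bump_eq_0)

lemma test_function_bump:
  assumes "cbox a b \<subseteq> D" shows "test_function D (bump a b m)"
proof -
  have "closure {x. bump a b m x \<noteq> 0} \<subseteq> cbox a b"
    using bump_eq_0[of _ a b m] box_subset_cbox[of a b] by (intro closure_minimal) auto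
  then show ?thesis
    using assms compact_cbox[of a b]
    by (auto simp: test_function_def smooth_bump compact_eq_bounded_closed intro: bounded_subset[OF bounded_cbox])
qed

section \<open>Semi-inner product spaces and the Riesz representation theorem\<close>

definition ip_norm :: "(('x \<Rightarrow> complex) \<Rightarrow> ('x \<Rightarrow> complex) \<Rightarrow> complex) \<Rightarrow> ('x \<Rightarrow> complex) \<Rightarrow> real" where
  "ip_norm ip u = sqrt (Re (ip u u))"

definition ip_Cauchy ::
  "('x \<Rightarrow> complex) set \<Rightarrow> (('x \<Rightarrow> complex) \<Rightarrow> ('x \<Rightarrow> complex) \<Rightarrow> complex) \<Rightarrow> (nat \<Rightarrow> 'x \<Rightarrow> complex) \<Rightarrow> bool"
  where
  "ip_Cauchy V ip f \<longleftrightarrow> (\<forall>n. f n \<in> V) \<and>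
     (\<forall>e>0. \<exists>N. \<forall>m\<ge>N. \<forall>n\<ge>N. ip_norm ip (\<lambda>x. f m x - f n x) < e)"

definition ip_complete ::
  "('x \<Rightarrow> complex) set \<Rightarrow> (('x \<Rightarrow> complex) \<Rightarrow> ('x \<Rightarrow> complex) \<Rightarrow> complex) \<Rightarrow> bool" where
  "ip_complete V ip \<longleftrightarrow>
     (\<forall>f. ip_Cauchy V ip f \<longrightarrow> (\<exists>u\<in>V. (\<lambda>n. ip_norm ip (\<lambda>x. f n x - u x)) \<longlonglongrightarrow> 0))"

text \<open>The form may be degenerate: the elements are representatives of classes of functions.\<close>

locale semi_inner_space =
  fixes V :: "('x \<Rightarrow> complex) set" and ip :: "('x \<Rightarrow> complex) \<Rightarrow> ('x \<Rightarrow> complex) \<Rightarrow> complex"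
  assumes zero_in: "(\<lambda>_. 0) \<in> V"
    and add_in: "u \<in> V \<Longrightarrow> v \<in> V \<Longrightarrow> (\<lambda>x. u x + v x) \<in> V"
    and scale_in: "u \<in> V \<Longrightarrow> (\<lambda>x. c * u x) \<in> V"
    and ip_add: "u \<in> V \<Longrightarrow> v \<in> V \<Longrightarrow> w \<in> V \<Longrightarrow> ip (\<lambda>x. u x + v x) w = ip u w + ip v w"
    and ip_scale: "u \<in> V \<Longrightarrow> w \<in> V \<Longrightarrow> ip (\<lambda>x. c * u x) w = c * ip u w"
    and ip_cnj: "u \<in> V \<Longrightarrow> v \<in> V \<Longrightarrow> ip v u = cnj (ip u v)"
    and ip_nonneg: "u \<in> V \<Longrightarrow> 0 \<le> Re (ip u u)"
begin

abbreviation "nrm \<equiv> ip_norm ip"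

lemmas nrm_def = ip_norm_def[of ip]

lemma nrm_nonneg: "u \<in> V \<Longrightarrow> 0 \<le> nrm u"
  by (simp add: nrm_def ip_nonneg)

lemma nrm_sq: "u \<in> V \<Longrightarrow> (nrm u)\<^sup>2 = Re (ip u u)"
  by (simp add: nrm_def ip_nonneg)

lemma diff_in: "u \<in> V \<Longrightarrow> v \<in> V \<Longrightarrow> (\<lambda>x. u x - v x) \<in> V"
  using add_in[of u "\<lambda>x. -1 * v x"] scale_in[of v "-1"] by simp

lemma ip_diff: "u \<in> V \<Longrightarrow> v \<in> V \<Longrightarrow> w \<in> V \<Longrightarrow> ip (\<lambda>x. u x - v x) w = ip u w - ip v w"
  using ip_add[of u "\<lambda>x. -1 * v x" w] scale_in[of v "-1"] ip_scale[of v w "-1"] by simp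

lemma ip_add_right: "u \<in> V \<Longrightarrow> v \<in> V \<Longrightarrow> w \<in> V \<Longrightarrow> ip w (\<lambda>x. u x + v x) = ip w u + ip w v"
  using ip_cnj[OF add_in[of u v], of w] ip_cnj[of u w] ip_cnj[of v w] ip_add[of u v w] by simp

lemma ip_scale_right: "u \<in> V \<Longrightarrow> w \<in> V \<Longrightarrow> ip w (\<lambda>x. c * u x) = cnj c * ip w u"
  using ip_cnj[OF scale_in[of u c], of w] ip_cnj[of u w] ip_scale[of u w c] by simp

lemma nrm_add_scale_sq:
  assumes "u \<in> V" "v \<in> V"
  shows "(nrm (\<lambda>x. u x + c * v x))\<^sup>2 = (nrm u)\<^sup>2 + 2 * Re (cnj c * ip u v) + (cmod c)\<^sup>2 * (nrm v)\<^sup>2"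
proof -
  have "ip (\<lambda>x. u x + c * v x) (\<lambda>x. u x + c * v x) =
      ip u u + cnj c * ip u v + cnj (cnj c * ip u v) + c * cnj c * ip v v"
    using assms ip_cnj[OF assms]
    by (simp add: ip_add ip_scale ip_add_right ip_scale_right add_in scale_in algebra_simps)
  moreover have "Re (c * cnj c * ip v v) = (cmod c)\<^sup>2 * Re (ip v v)"
    by (simp only: complex_norm_square[symmetric] Re_complex_of_real flip: of_real_power) simp
  ultimately show ?thesis
    using assms by (simp add: nrm_sq add_in scale_in)
qed

lemma Cauchy_Schwarz:
  assumes "u \<in> V" "v \<in> V"
  shows "cmod (ip u v) \<le> nrm u * nrm v"
proof -
  obtain z where z: "cmod z = 1" "cnj z * ip u v = complex_of_real (cmod (ip u v))"
  proof (cases "ip u v = 0")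
    case False
    let ?z = "ip u v / complex_of_real (cmod (ip u v))"
    have "cnj ?z * ip u v = complex_of_real (cmod (ip u v))"
      using False by (simp add: complex_norm_square[symmetric] mult.commute power2_eq_square field_simps)
    then show ?thesis using False by (intro that[of ?z]) (auto simp: norm_divide)
  qed (use that[of 1] in auto)
  define s where "s = cmod (ip u v)"
  have quad: "0 \<le> (nrm u)\<^sup>2 + 2 * t * s + t\<^sup>2 * (nrm v)\<^sup>2" for t :: real
  proof -
    have "0 \<le> (nrm (\<lambda>x. u x + (of_real t * z) * v x))\<^sup>2" by simp
    also have "\<dots> = (nrm u)\<^sup>2 + 2 * Re (of_real t * (cnj z * ip u v)) + t\<^sup>2 * (nrm v)\<^sup>2"
      using z(1) by (subst nrm_add_scale_sq[OF assms]) (simp add: norm_mult power_mult_distrib mult.assoc)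
    also have "\<dots> = (nrm u)\<^sup>2 + 2 * t * s + t\<^sup>2 * (nrm v)\<^sup>2"
      by (simp only: z(2) s_def) simp
    finally show ?thesis .
  qed
  have s0: "0 \<le> s" by (simp add: s_def)
  have "s \<le> nrm u * nrm v"
  proof (cases "nrm v = 0")
    case True
    have "s = 0"
    proof (rule ccontr)
      assume "s \<noteq> 0"
      with quad[of "- ((nrm u)\<^sup>2 + 1) / (2 * s)"] True show False by (simp add: field_simps)
    qed
    with True show ?thesis by simp
  next
    case False
    then have nv: "0 < (nrm v)\<^sup>2" by simp
    have "2 * (- s / w) * s + (- s / w)\<^sup>2 * w = - s\<^sup>2 / w" if "w > 0" for w
      using that by (simp add: power2_eq_square field_simps)
    from this[OF nv] quad[of "- s / (nrm v)\<^sup>2"] have "0 \<le> (nrm u)\<^sup>2 - s\<^sup>2 / (nrm v)\<^sup>2"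
      by simp
    then have "s\<^sup>2 \<le> (nrm u * nrm v)\<^sup>2" using nv by (simp add: field_simps power_mult_distrib)
    then show ?thesis
      by (rule power2_le_imp_le) (simp add: assms nrm_nonneg)
  qed
  then show ?thesis by (simp add: s_def)
qed

lemma nrm_scale: "u \<in> V \<Longrightarrow> nrm (\<lambda>x. c * u x) = cmod c * nrm u"
proof -
  assume u: "u \<in> V"
  have "ip (\<lambda>x. c * u x) (\<lambda>x. c * u x) = of_real ((cmod c)\<^sup>2) * ip u u"
    using u by (simp add: ip_scale ip_scale_right scale_in complex_norm_square mult_ac flip: of_real_power)
  then show ?thesis by (simp add: nrm_def real_sqrt_mult)
qed

lemma nrm_triangle:
  assumes "u \<in> V" "v \<in> V"
  shows "nrm (\<lambda>x. u x + v x) \<le> nrm u + nrm v"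
proof (rule power2_le_imp_le)
  have "(nrm (\<lambda>x. u x + v x))\<^sup>2 = (nrm u)\<^sup>2 + 2 * Re (ip u v) + (nrm v)\<^sup>2"
    using nrm_add_scale_sq[OF assms, of 1] by simp
  also have "\<dots> \<le> (nrm u)\<^sup>2 + 2 * (nrm u * nrm v) + (nrm v)\<^sup>2"
    using Cauchy_Schwarz[OF assms] complex_Re_le_cmod[of "ip u v"] by linarith
  finally show "(nrm (\<lambda>x. u x + v x))\<^sup>2 \<le> (nrm u + nrm v)\<^sup>2"
    by (simp add: power2_sum)
qed (simp add: assms nrm_nonneg)

lemma nrm_minus_commute: "u \<in> V \<Longrightarrow> v \<in> V \<Longrightarrow> nrm (\<lambda>x. u x - v x) = nrm (\<lambda>x. v x - u x)"
  using nrm_scale[OF diff_in[of v u], of "-1"] by simp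

lemma nrm_diff_triangle:
  assumes "u \<in> V" "v \<in> V" "w \<in> V"
  shows "nrm (\<lambda>x. u x - w x) \<le> nrm (\<lambda>x. u x - v x) + nrm (\<lambda>x. v x - w x)"
  using nrm_triangle[OF diff_in[OF assms(1,2)] diff_in[OF assms(2,3)]] by simp

lemma nrm_zero: "nrm (\<lambda>x. 0) = 0"
  using nrm_scale[OF zero_in, of 0] by simp

lemma nrm_tendsto:
  assumes "\<And>n. f n \<in> V" "u \<in> V" "(\<lambda>n. nrm (\<lambda>x. f n x - u x)) \<longlonglongrightarrow> 0"
  shows "(\<lambda>n. nrm (f n)) \<longlonglongrightarrow> nrm u"
proof -
  have "\<bar>nrm (f n) - nrm u\<bar> \<le> nrm (\<lambda>x. f n x - u x)" for n
    using nrm_triangle[OF diff_in[OF assms(1,2)] assms(2), of n]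
      nrm_triangle[OF diff_in[OF assms(2) assms(1)] assms(1), of n n]
      nrm_minus_commute[OF assms(1,2), of n] by simp
  then have "(\<lambda>n. nrm (f n) - nrm u) \<longlonglongrightarrow> 0"
    by (intro Lim_null_comparison[OF _ assms(3)]) auto
  then show ?thesis by (simp add: LIM_zero_iff)
qed

text \<open>
  The representative minimises \<open>nrm\<^sup>2 - 2 Re G\<close>; a minimising sequence is Cauchy by the
  parallelogram law.
\<close>

theorem Riesz:
  fixes G :: "('x \<Rightarrow> complex) \<Rightarrow> complex"
  assumes complete: "ip_complete V ip"
    and G_add: "\<And>u v. u \<in> V \<Longrightarrow> v \<in> V \<Longrightarrow> G (\<lambda>x. u x + v x) = G u + G v"
    and G_scale: "\<And>c u. u \<in> V \<Longrightarrow> G (\<lambda>x. c * u x) = cnj c * G u"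
    and G_bound: "\<And>u. u \<in> V \<Longrightarrow> cmod (G u) \<le> C * nrm u"
  shows "\<exists>w\<in>V. \<forall>u\<in>V. ip w u = G u"
proof -
  define Q where "Q u = (nrm u)\<^sup>2 - 2 * Re (G u)" for u
  have Q_bound: "- C\<^sup>2 \<le> Q u" if "u \<in> V" for u
  proof -
    have "Re (G u) \<le> C * nrm u"
      using G_bound[OF that] complex_Re_le_cmod[of "G u"] by linarith
    moreover have "0 \<le> (nrm u - C)\<^sup>2" by simp
    ultimately show ?thesis by (simp add: Q_def power2_diff algebra_simps)
  qed
  define m where "m = Inf (Q ` V)"
  have bdd: "bdd_below (Q ` V)" using Q_bound by (auto intro!: bdd_belowI[of _ "- C\<^sup>2"])
  have m_le: "m \<le> Q u" if "u \<in> V" for u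
    unfolding m_def using bdd that by (auto intro: cInf_lower)
  have "\<exists>u\<in>V. Q u < m + 1 / real (Suc n)" for n
    using cInf_lessD[of "Q ` V" "m + 1 / real (Suc n)"] zero_in by (auto simp: m_def)
  then obtain f where f: "\<And>n. f n \<in> V" "\<And>n. Q (f n) < m + 1 / real (Suc n)" by metis
  have par: "(nrm (\<lambda>x. f i x - f j x))\<^sup>2 \<le> 2 / real (Suc i) + 2 / real (Suc j)" for i j
  proof -
    let ?h = "\<lambda>x. (1 / 2) * (f i x + f j x)"
    have h: "?h \<in> V" by (intro scale_in add_in f)
    have "(nrm (\<lambda>x. f i x + f j x))\<^sup>2 + (nrm (\<lambda>x. f i x - f j x))\<^sup>2 = 2 * (nrm (f i))\<^sup>2 + 2 * (nrm (f j))\<^sup>2"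
      using nrm_add_scale_sq[OF f(1) f(1), of i 1 j] nrm_add_scale_sq[OF f(1) f(1), of i "-1" j] by simp
    moreover have "4 * Q ?h = (nrm (\<lambda>x. f i x + f j x))\<^sup>2 - 4 * Re (G (f i)) - 4 * Re (G (f j))"
      unfolding Q_def nrm_scale[OF add_in[OF f(1) f(1)]] G_scale[OF add_in[OF f(1) f(1)]] G_add[OF f(1) f(1)]
      by (simp add: power_divide add_divide_distrib)
    ultimately have "(nrm (\<lambda>x. f i x - f j x))\<^sup>2 = 2 * Q (f i) + 2 * Q (f j) - 4 * Q ?h"
      using Q_def[of "f i"] Q_def[of "f j"] by argo
    then show ?thesis using f(2)[of i] f(2)[of j] m_le[OF h] by simp
  qed
  have "ip_Cauchy V ip f"
    unfolding ip_Cauchy_def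
  proof (intro conjI allI impI f)
    fix e :: real assume "e > 0"
    obtain N' where "4 / e\<^sup>2 < real N'" using reals_Archimedean2 by blast
    then have N: "4 / e\<^sup>2 < real (Suc N')" "0 < Suc N'" by auto
    define N where "N = Suc N'"
    note N = N[folded N_def]
    have "nrm (\<lambda>x. f i x - f j x) < e" if "i \<ge> N" "j \<ge> N" for i j
    proof (rule power2_less_imp_less)
      have "2 / real (Suc i) \<le> 2 / real N" "2 / real (Suc j) \<le> 2 / real N"
        using that N by (auto intro!: divide_left_mono)
      with par[of i j] have "(nrm (\<lambda>x. f i x - f j x))\<^sup>2 \<le> 4 / real N" by simp
      also have "\<dots> < e\<^sup>2" using N \<open>e > 0\<close> by (simp add: field_simps)
      finally show "(nrm (\<lambda>x. f i x - f j x))\<^sup>2 < e\<^sup>2" .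
    qed (use \<open>e > 0\<close> in simp)
    then show "\<exists>N. \<forall>i\<ge>N. \<forall>j\<ge>N. nrm (\<lambda>x. f i x - f j x) < e" by blast
  qed
  then obtain w where w: "w \<in> V" "(\<lambda>n. nrm (\<lambda>x. f n x - w x)) \<longlonglongrightarrow> 0"
    using complete by (auto simp: ip_complete_def)
  have G_diff: "G (\<lambda>x. u x - v x) = G u - G v" if "u \<in> V" "v \<in> V" for u v
    using G_add[OF that(1) scale_in[OF that(2), of "-1"]] G_scale[OF that(2), of "-1"] by simp
  have lim: "(\<lambda>n. C * nrm (\<lambda>x. f n x - w x)) \<longlonglongrightarrow> 0"
    using tendsto_mult_left[OF w(2), of C] by simp
  have "norm (G (f n) - G w) \<le> C * nrm (\<lambda>x. f n x - w x)" for n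
    using G_bound[OF diff_in[OF f(1)[of n] w(1)]] G_diff[OF f(1)[of n] w(1)] by simp
  then have "(\<lambda>n. G (f n) - G w) \<longlonglongrightarrow> 0"
    by (rule Lim_null_comparison[OF always_eventually[OF allI] lim])
  then have "(\<lambda>n. G (f n)) \<longlonglongrightarrow> G w" by (simp add: LIM_zero_iff)
  then have "(\<lambda>n. Q (f n)) \<longlonglongrightarrow> Q w"
    unfolding Q_def by (intro tendsto_intros nrm_tendsto f w)
  moreover have "(\<lambda>n. m + 1 / real (Suc n)) \<longlonglongrightarrow> m + 0"
    by (intro tendsto_intros LIMSEQ_Suc lim_1_over_n)
  ultimately have "Q w \<le> m + 0"
    by (rule LIMSEQ_le) (use f(2) in \<open>auto intro: less_imp_le\<close>)
  then have min: "Q w \<le> Q u" if "u \<in> V" for u using m_le[OF that] by simp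
  have Re0: "Re (ip w u - G u) = 0" if u: "u \<in> V" for u
  proof (rule ccontr)
    define r where "r = Re (ip w u - G u)"
    assume "Re (ip w u - G u) \<noteq> 0"
    then have r: "r \<noteq> 0" by (simp add: r_def)
    have pos: "0 \<le> 2 * t * r + t\<^sup>2 * (nrm u)\<^sup>2" for t :: real
    proof -
      have "Q (\<lambda>x. w x + of_real t * u x) = Q w + 2 * t * r + t\<^sup>2 * (nrm u)\<^sup>2"
        by (simp add: Q_def nrm_add_scale_sq[OF w(1) u] G_add[OF w(1) scale_in[OF u]] G_scale[OF u]
            r_def algebra_simps)
      with min[OF add_in[OF w(1) scale_in[OF u]], of "of_real t"] show ?thesis by simp
    qed
    define t where "t = - r / ((nrm u)\<^sup>2 + 1)"
    have d: "(nrm u)\<^sup>2 + 1 > 0" by (simp add: add_nonneg_pos)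
    have "2 * t * r + t\<^sup>2 * (nrm u)\<^sup>2 \<le> 2 * t * r + t\<^sup>2 * ((nrm u)\<^sup>2 + 1)"
      by (simp add: mult_left_mono)
    also have "\<dots> = - r\<^sup>2 / ((nrm u)\<^sup>2 + 1)"
    proof -
      have "2 * (- r / y) * r + (- r / y)\<^sup>2 * y = - r\<^sup>2 / y" if "y > 0" for y
        using that by (simp add: power2_eq_square field_simps)
      from this[OF d] show ?thesis by (simp add: t_def)
    qed
    also have "\<dots> < 0" using d r by simp
    finally show False using pos[of t] by simp
  qed
  have "ip w u = G u" if u: "u \<in> V" for u
  proof -
    have "Re (ip w (\<lambda>x. \<i> * u x) - G (\<lambda>x. \<i> * u x)) = 0"
      by (intro Re0 scale_in u)
    then have "Im (ip w u - G u) = 0"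
      using u w(1) by (simp add: ip_scale_right G_scale)
    with Re0[OF u] show ?thesis by (simp add: complex_eq_iff)
  qed
  with w(1) show ?thesis by blast
qed

lemma sum_in: "finite S \<Longrightarrow> (\<And>i. i \<in> S \<Longrightarrow> f i \<in> V) \<Longrightarrow> (\<lambda>x. \<Sum>i\<in>S. f i x) \<in> V"
  by (induction S rule: finite_induct) (auto simp: zero_in add_in)

lemma nrm_sum_le:
  "finite S \<Longrightarrow> (\<And>i. i \<in> S \<Longrightarrow> f i \<in> V) \<Longrightarrow> nrm (\<lambda>x. \<Sum>i\<in>S. f i x) \<le> (\<Sum>i\<in>S. nrm (f i))"
proof (induction S rule: finite_induct)
  case empty
  then show ?case by (simp add: nrm_zero)
next
  case (insert j S)
  have "nrm (\<lambda>x. f j x + (\<Sum>i\<in>S. f i x)) \<le> nrm (f j) + nrm (\<lambda>x. \<Sum>i\<in>S. f i x)"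
    using insert.prems insert.hyps(1) by (intro nrm_triangle sum_in) auto
  with insert show ?case by simp
qed

lemma nrm_le_if_ip_le:
  assumes w: "w \<in> V" and bound: "\<And>u. u \<in> V \<Longrightarrow> cmod (ip w u) \<le> C * nrm u" and C: "0 \<le> C"
  shows "nrm w \<le> C"
proof (cases "nrm w = 0")
  case False
  then have pos: "0 < nrm w" using nrm_nonneg[OF w] by simp
  have "nrm w * nrm w \<le> C * nrm w"
    using bound[OF w] complex_Re_le_cmod[of "ip w w"] nrm_sq[OF w] by (simp add: power2_eq_square)
  then show ?thesis using pos by simp
qed (use C in simp)

text \<open>
  By Riesz, \<open>F\<close> is representable if and only if \<open>F + G\<close> is; if neither is, both choices are made
  from the empty predicate and agree.
\<close>

lemma nrm_Eps_representer_diff: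
  assumes complete: "ip_complete V ip" and C: "0 \<le> C"
    and G_add: "\<And>u v. u \<in> V \<Longrightarrow> v \<in> V \<Longrightarrow> G (\<lambda>x. u x + v x) = G u + G v"
    and G_scale: "\<And>c u. u \<in> V \<Longrightarrow> G (\<lambda>x. c * u x) = cnj c * G u"
    and G_bound: "\<And>u. u \<in> V \<Longrightarrow> cmod (G u) \<le> C * nrm u"
    and F': "\<And>u. u \<in> V \<Longrightarrow> F' u = F u + G u"
  shows "nrm (\<lambda>x. (SOME w. w \<in> V \<and> (\<forall>u\<in>V. ip w u = F' u)) x - (SOME w. w \<in> V \<and> (\<forall>u\<in>V. ip w u = F u)) x) \<le> C"
proof -
  define P where "P F w \<longleftrightarrow> w \<in> V \<and> (\<forall>u\<in>V. ip w u = F u)" for F :: "('x \<Rightarrow> complex) \<Rightarrow> complex" and w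
  obtain g where g: "g \<in> V" "\<And>u. u \<in> V \<Longrightarrow> ip g u = G u"
    using Riesz[OF complete G_add G_scale G_bound] by blast
  have "nrm (\<lambda>x. Eps (P F') x - Eps (P F) x) \<le> C"
  proof (cases "\<exists>w. P F w")
    case True
    then obtain w where w: "P F w" by blast
    then have "P F' (\<lambda>x. w x + g x)"
      using g by (simp add: P_def add_in ip_add F')
    then have 1: "P F' (Eps (P F'))" by (rule someI[where P = "P F'"])
    have 0: "P F (Eps (P F))" using w by (rule someI[where P = "P F"])
    have "ip (\<lambda>x. Eps (P F') x - Eps (P F) x) u = G u" if "u \<in> V" for u
      using 0 1 that by (simp add: P_def ip_diff F')
    then show ?thesis
      using 0 1 G_bound C by (intro nrm_le_if_ip_le diff_in) (simp_all add: P_def)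
  next
    case False
    have "\<not> P F' w" for w
    proof
      assume w: "P F' w"
      then have "P F (\<lambda>x. w x - g x)"
        using g by (simp add: P_def diff_in ip_diff F')
      with False show False by blast
    qed
    with False have "P F' = P F" by blast
    then show ?thesis using C by (simp add: nrm_zero)
  qed
  then show ?thesis by (simp add: P_def[abs_def])
qed

end

section \<open>The space \<open>L\<^sup>2\<close>\<close>

lemma L2_measurable: "f \<in> L2 M \<Longrightarrow> f \<in> borel_measurable M"
  by (simp add: L2_def)

lemma L2_square_integrable: "f \<in> L2 M \<Longrightarrow> integrable M (\<lambda>x. (norm (f x))\<^sup>2)"
  by (simp add: L2_def)

lemma L2_mult_integrable:
  assumes "f \<in> L2 M" "g \<in> L2 M"
  shows "integrable M (\<lambda>x. f x * g x)"
proof (rule Bochner_Integration.integrable_bound)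
  show "integrable M (\<lambda>x. (norm (f x))\<^sup>2 + (norm (g x))\<^sup>2)"
    using assms by (intro Bochner_Integration.integrable_add L2_square_integrable)
  show "(\<lambda>x. f x * g x) \<in> borel_measurable M"
    using assms by (intro borel_measurable_times L2_measurable)
  have "a * b \<le> a\<^sup>2 + b\<^sup>2" if "0 \<le> a" "0 \<le> b" for a b :: real
    using sum_squares_bound[of a b] mult_nonneg_nonneg[OF that] by linarith
  then show "AE x in M. norm (f x * g x) \<le> norm ((norm (f x))\<^sup>2 + (norm (g x))\<^sup>2)"
    by (simp add: norm_mult)
qed

lemma L2_bounded_mult:
  assumes g: "g \<in> borel_measurable M" "AE x in M. norm (g x) \<le> C" and f: "f \<in> L2 M"
  shows "(\<lambda>x. g x * f x) \<in> L2 M"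
  unfolding L2_def
proof (intro CollectI conjI)
  show m: "(\<lambda>x. g x * f x) \<in> borel_measurable M"
    using g(1) L2_measurable[OF f] by (rule borel_measurable_times)
  have "integrable M (\<lambda>x. C\<^sup>2 * (norm (f x))\<^sup>2)"
    using L2_square_integrable[OF f] by simp
  then show "integrable M (\<lambda>x. (norm (g x * f x))\<^sup>2)"
  proof (rule Bochner_Integration.integrable_bound)
    show "AE x in M. norm ((norm (g x * f x))\<^sup>2) \<le> norm (C\<^sup>2 * (norm (f x))\<^sup>2)"
      using g(2) by eventually_elim (auto simp: norm_mult power_mult_distrib intro!: mult_right_mono power_mono)
  qed (use m in measurable)
qed

lemma L2_scale: "f \<in> L2 M \<Longrightarrow> (\<lambda>x. c * f x) \<in> L2 M"
  by (rule L2_bounded_mult[where C = "norm c"]) auto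

lemma borel_measurable_cnj: "f \<in> borel_measurable M \<Longrightarrow> (\<lambda>x. cnj (f x)) \<in> borel_measurable M"
  by (rule borel_measurable_continuous_on[of cnj]) (auto intro: continuous_intros)

lemma L2_cnj: "f \<in> L2 M \<Longrightarrow> (\<lambda>x. cnj (f x)) \<in> L2 M"
  by (auto simp: L2_def borel_measurable_cnj)

lemma L2_zero: "(\<lambda>x. 0) \<in> L2 M"
  by (simp add: L2_def)

lemma L2_add:
  assumes "f \<in> L2 M" "g \<in> L2 M"
  shows "(\<lambda>x. f x + g x) \<in> L2 M"
  unfolding L2_def
proof (intro CollectI conjI)
  show m: "(\<lambda>x. f x + g x) \<in> borel_measurable M"
    using assms by (intro borel_measurable_add L2_measurable)
  have "integrable M (\<lambda>x. 2 * (norm (f x))\<^sup>2 + 2 * (norm (g x))\<^sup>2)"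
    using assms by (intro Bochner_Integration.integrable_add integrable_mult_right L2_square_integrable)
  then show "integrable M (\<lambda>x. (norm (f x + g x))\<^sup>2)"
  proof (rule Bochner_Integration.integrable_bound)
    have "(norm (f x + g x))\<^sup>2 \<le> 2 * (norm (f x))\<^sup>2 + 2 * (norm (g x))\<^sup>2" for x
    proof -
      have "(norm (f x + g x))\<^sup>2 \<le> (norm (f x) + norm (g x))\<^sup>2"
        by (intro power_mono norm_triangle_ineq norm_ge_zero)
      also have "\<dots> \<le> 2 * (norm (f x))\<^sup>2 + 2 * (norm (g x))\<^sup>2"
        using sum_squares_bound[of "norm (f x)" "norm (g x)"] by (simp add: power2_sum)
      finally show ?thesis .
    qed
    then show "AE x in M. norm ((norm (f x + g x))\<^sup>2) \<le> norm (2 * (norm (f x))\<^sup>2 + 2 * (norm (g x))\<^sup>2)"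
      by simp
  qed (use m in measurable)
qed

lemma L2_cong_AE:
  assumes "f \<in> L2 M" "g \<in> borel_measurable M" "AE x in M. f x = g x"
  shows "g \<in> L2 M"
proof -
  have "integrable M (\<lambda>x. (norm (f x))\<^sup>2) \<longleftrightarrow> integrable M (\<lambda>x. (norm (g x))\<^sup>2)"
    using assms(1,2) L2_measurable[of f M] by (intro integrable_cong_AE) (use assms(3) in auto)
  then show ?thesis using assms by (simp add: L2_def)
qed

lemma L2_inner_cong_AE:
  assumes "f \<in> L2 M" "g \<in> L2 M" "f' \<in> L2 M" "g' \<in> L2 M"
    and "AE x in M. f x = f' x" "AE x in M. g x = g' x"
  shows "L2_inner M f g = L2_inner M f' g'"
  unfolding L2_inner_def
proof (rule integral_cong_AE)
  show "AE x in M. f x * cnj (g x) = f' x * cnj (g' x)"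
    using assms(5,6) by eventually_elim simp
qed (intro borel_measurable_integrable L2_mult_integrable L2_cnj assms)+

lemma semi_inner_space_L2: "semi_inner_space (L2 M) (L2_inner M)"
proof
  fix u v w :: "'a \<Rightarrow> complex" and c :: complex
  assume u: "u \<in> L2 M"
  note int = L2_mult_integrable[OF _ L2_cnj]
  show "(\<lambda>x. c * u x) \<in> L2 M" using u by (rule L2_scale)
  show "0 \<le> Re (L2_inner M u u)"
    unfolding L2_inner_def using u
    by (subst integral_Re[symmetric]) (auto intro!: int integral_nonneg_AE)
  {
    assume w: "w \<in> L2 M"
    show "L2_inner M (\<lambda>x. c * u x) w = c * L2_inner M u w"
      by (simp add: L2_inner_def mult.assoc)
    show "L2_inner M w u = cnj (L2_inner M u w)"
      using Bochner_Integration.integral_cnj[of M "\<lambda>x. u x * cnj (w x)"] by (simp add: L2_inner_def mult.commute)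
  }
  assume v: "v \<in> L2 M"
  show "(\<lambda>x. u x + v x) \<in> L2 M" using u v by (rule L2_add)
  assume w: "w \<in> L2 M"
  show "L2_inner M (\<lambda>x. u x + v x) w = L2_inner M u w + L2_inner M v w"
    using int[OF u w] int[OF v w] by (simp add: L2_inner_def distrib_right)
qed (rule L2_zero)

interpretation L2: semi_inner_space "L2 M" "L2_inner M" for M
  by (rule semi_inner_space_L2)

lemma L2_norm_sq:
  assumes "f \<in> L2 M"
  shows "ennreal ((ip_norm (L2_inner M) f)\<^sup>2) = (\<integral>\<^sup>+x. ennreal ((norm (f x))\<^sup>2) \<partial>M)"
proof -
  have "(ip_norm (L2_inner M) f)\<^sup>2 = (\<integral>x. (norm (f x))\<^sup>2 \<partial>M)"
    unfolding L2.nrm_sq[OF assms] L2_inner_def complex_norm_square[symmetric]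
    by (simp flip: of_real_power)
  then show ?thesis
    by (simp add: nn_integral_eq_integral[OF L2_square_integrable[OF assms]])
qed

lemma ennreal_le_suminf: "a k \<le> suminf a" for a :: "nat \<Rightarrow> ennreal"
  using sum_le_suminf[of a "{k}"] by (simp add: summableI)

lemma L2_complete: "ip_complete (L2 M) (L2_inner M)"
  unfolding ip_complete_def
proof (intro allI impI)
  fix f assume "ip_Cauchy (L2 M) (L2_inner M) f"
  then have f: "\<And>n. f n \<in> L2 M"
    and Cau: "\<And>e. 0 < e \<Longrightarrow> \<exists>N. \<forall>m\<ge>N. \<forall>n\<ge>N. ip_norm (L2_inner M) (\<lambda>x. f m x - f n x) < e"
    by (auto simp: ip_Cauchy_def)
  have [measurable]: "f n \<in> borel_measurable M" for n by (rule L2_measurable[OF f])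
  text \<open>A subsequence with increments of norm at most \<open>(1/4) ^ k\<close>; integrating them with weight
    \<open>4 ^ k\<close> gives a geometric bound almost everywhere.\<close>
  have "\<forall>k. \<exists>N. \<forall>m\<ge>N. \<forall>n\<ge>N. ip_norm (L2_inner M) (\<lambda>x. f m x - f n x) < (1/4) ^ k"
    using Cau by simp
  then obtain N where N: "\<And>k m n. m \<ge> N k \<Longrightarrow> n \<ge> N k \<Longrightarrow> ip_norm (L2_inner M) (\<lambda>x. f m x - f n x) < (1/4) ^ k"
    by metis
  define r where "r k = (\<Sum>i\<le>k. N i) + k" for k
  have rN: "N k \<le> r k" for k
    unfolding r_def by (intro trans_le_add1 member_le_sum) auto
  have rS: "r k \<le> r (Suc k)" for k by (simp add: r_def)
  have rk: "k \<le> r k" for k by (simp add: r_def)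
  define d where "d k x = f (r (Suc k)) x - f (r k) x" for k x
  have d: "d k \<in> L2 M" for k
    unfolding d_def[abs_def] by (intro L2.diff_in f)
  have [measurable]: "d k \<in> borel_measurable M" for k by (rule L2_measurable[OF d])
  have dn: "(\<integral>\<^sup>+x. ennreal (4 ^ k * (norm (d k x))\<^sup>2) \<partial>M) \<le> ennreal ((1/4) ^ k)" for k
  proof -
    have "ip_norm (L2_inner M) (d k) \<le> (1/4) ^ k"
      unfolding d_def[abs_def] using rN[of k] rS[of k] by (intro less_imp_le[OF N]) auto
    then have "(ip_norm (L2_inner M) (d k))\<^sup>2 \<le> ((1/4) ^ k)\<^sup>2"
      by (intro power_mono L2.nrm_nonneg d)
    then have "4 ^ k * (ip_norm (L2_inner M) (d k))\<^sup>2 \<le> 4 ^ k * ((1/4) ^ k)\<^sup>2" by simp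
    also have "\<dots> = (1/4) ^ k"
      by (simp add: power2_eq_square flip: power_mult_distrib mult.assoc)
    finally show ?thesis
      unfolding ennreal_mult[OF zero_le_power[OF zero_le_numeral] zero_le_power2]
      by (subst nn_integral_cmult) (auto simp: L2_norm_sq[OF d, symmetric] ennreal_mult[symmetric] intro: ennreal_leI)
  qed
  have "(\<integral>\<^sup>+x. (\<Sum>k. ennreal (4 ^ k * (norm (d k x))\<^sup>2)) \<partial>M)
      = (\<Sum>k. \<integral>\<^sup>+x. ennreal (4 ^ k * (norm (d k x))\<^sup>2) \<partial>M)"
    by (rule nn_integral_suminf) measurable
  also have "\<dots> \<le> (\<Sum>k. ennreal ((1/4) ^ k))"
    by (rule suminf_le[OF dn]) auto
  also have "\<dots> = ennreal (\<Sum>k. (1/4) ^ k)"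
    by (rule suminf_ennreal2) (auto intro: summable_geometric)
  finally have "(\<integral>\<^sup>+x. (\<Sum>k. ennreal (4 ^ k * (norm (d k x))\<^sup>2)) \<partial>M) \<noteq> \<infinity>"
    by (metis ennreal_less_top infinity_ennreal_def leD)
  moreover have "(\<lambda>x. \<Sum>k. ennreal (4 ^ k * (norm (d k x))\<^sup>2)) \<in> borel_measurable M"
    by (rule borel_measurable_suminf_order) measurable
  ultimately have "AE x in M. (\<Sum>k. ennreal (4 ^ k * (norm (d k x))\<^sup>2)) \<noteq> \<infinity>"
    using nn_integral_noteq_infinite by blast
  then have conv: "AE x in M. (\<lambda>k. f (r k) x) \<longlonglongrightarrow> lim (\<lambda>k. f (r k) x)"
  proof eventually_elim
    fix x assume fin: "(\<Sum>k. ennreal (4 ^ k * (norm (d k x))\<^sup>2)) \<noteq> \<infinity>"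
    define K where "K = enn2real (\<Sum>k. ennreal (4 ^ k * (norm (d k x))\<^sup>2))"
    have "norm (d k x) \<le> sqrt K * (1/2) ^ k" for k
    proof -
      have "ennreal (4 ^ k * (norm (d k x))\<^sup>2) \<le> (\<Sum>k. ennreal (4 ^ k * (norm (d k x))\<^sup>2))"
        by (rule ennreal_le_suminf)
      also have "\<dots> = ennreal K" using fin by (simp add: K_def less_top)
      finally have "4 ^ k * (norm (d k x))\<^sup>2 \<le> K"
        by (rule iffD1[OF ennreal_le_iff, rotated]) (simp add: K_def)
      moreover have "4 ^ k * (norm (d k x))\<^sup>2 = (2 ^ k * norm (d k x))\<^sup>2"
        by (simp add: power_mult_distrib power2_eq_square flip: power_mult_distrib)
      ultimately have "2 ^ k * norm (d k x) \<le> sqrt K" by (metis real_le_rsqrt)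
      then show ?thesis by (simp add: power_one_over field_simps)
    qed
    moreover have "summable (\<lambda>k. sqrt K * (1/2) ^ k)"
      by (intro summable_mult summable_geometric) simp
    ultimately have "summable (\<lambda>k. d k x)"
      using summable_comparison_test'[of "\<lambda>k. sqrt K * (1/2) ^ k" 0 "\<lambda>k. d k x"] by blast
    then have "convergent (\<lambda>n. \<Sum>k<n. d k x)" by (simp add: summable_iff_convergent)
    moreover have "(\<Sum>k<n. d k x) = f (r n) x - f (r 0) x" for n
      unfolding d_def by (rule sum_lessThan_telescope)
    ultimately have "convergent (\<lambda>n. (f (r n) x - f (r 0) x) + f (r 0) x)"
      by (intro convergent_add convergent_const) simp
    then show "(\<lambda>k. f (r k) x) \<longlonglongrightarrow> lim (\<lambda>k. f (r k) x)"
      by (simp add: convergent_LIMSEQ_iff)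
  qed
  define u where "u x = lim (\<lambda>k. f (r k) x)" for x
  have [measurable]: "u \<in> borel_measurable M" unfolding u_def[abs_def] by measurable
  have key: "(\<integral>\<^sup>+x. ennreal ((norm (f m x - u x))\<^sup>2) \<partial>M) \<le> ennreal (e\<^sup>2)"
    if e: "0 < e" and M: "\<And>n. n \<ge> L \<Longrightarrow> ip_norm (L2_inner M) (\<lambda>x. f m x - f n x) < e" for m e L
  proof -
    have "(\<integral>\<^sup>+x. ennreal ((norm (f m x - u x))\<^sup>2) \<partial>M)
        = (\<integral>\<^sup>+x. liminf (\<lambda>k. ennreal ((norm (f m x - f (r k) x))\<^sup>2)) \<partial>M)"
    proof (rule nn_integral_cong_AE)
      show "AE x in M. ennreal ((norm (f m x - u x))\<^sup>2) = liminf (\<lambda>k. ennreal ((norm (f m x - f (r k) x))\<^sup>2))"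
        using conv
      proof eventually_elim
        fix x assume "(\<lambda>k. f (r k) x) \<longlonglongrightarrow> lim (\<lambda>k. f (r k) x)"
        then have "(\<lambda>k. ennreal ((norm (f m x - f (r k) x))\<^sup>2)) \<longlonglongrightarrow> ennreal ((norm (f m x - u x))\<^sup>2)"
          unfolding u_def by (intro tendsto_intros tendsto_ennrealI)
        then show "ennreal ((norm (f m x - u x))\<^sup>2) = liminf (\<lambda>k. ennreal ((norm (f m x - f (r k) x))\<^sup>2))"
          by (intro lim_imp_Liminf[symmetric]) auto
      qed
    qed
    also have "\<dots> \<le> liminf (\<lambda>k. \<integral>\<^sup>+x. ennreal ((norm (f m x - f (r k) x))\<^sup>2) \<partial>M)"
      by (rule nn_integral_liminf) measurable
    also have "\<dots> \<le> liminf (\<lambda>k. ennreal (e\<^sup>2))"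
    proof (rule Liminf_mono)
      have "(\<integral>\<^sup>+x. ennreal ((norm (f m x - f (r k) x))\<^sup>2) \<partial>M) \<le> ennreal (e\<^sup>2)" if "L \<le> k" for k
      proof -
        have "ip_norm (L2_inner M) (\<lambda>x. f m x - f (r k) x) \<le> e"
          using that rk[of k] by (intro less_imp_le[OF M]) auto
        then have "(ip_norm (L2_inner M) (\<lambda>x. f m x - f (r k) x))\<^sup>2 \<le> e\<^sup>2"
          by (intro power_mono L2.nrm_nonneg L2.diff_in f)
        then show ?thesis
          by (simp add: L2_norm_sq[symmetric] L2.diff_in f ennreal_leI)
      qed
      then show "\<forall>\<^sub>F k in sequentially. (\<integral>\<^sup>+x. ennreal ((norm (f m x - f (r k) x))\<^sup>2) \<partial>M) \<le> ennreal (e\<^sup>2)"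
        by (auto simp: eventually_sequentially)
    qed
    also have "\<dots> = ennreal (e\<^sup>2)" by (simp add: Liminf_const)
    finally show ?thesis .
  qed
  have diff: "(\<lambda>x. f m x - u x) \<in> L2 M"
    if "0 < e" "\<And>n. n \<ge> L \<Longrightarrow> ip_norm (L2_inner M) (\<lambda>x. f m x - f n x) < e" for m e L
  proof -
    have "(\<integral>\<^sup>+x. ennreal ((norm (f m x - u x))\<^sup>2) \<partial>M) \<le> ennreal (e\<^sup>2)"
      by (rule key[OF that(1)]) (rule that(2))
    then have "(\<integral>\<^sup>+x. ennreal ((norm (f m x - u x))\<^sup>2) \<partial>M) < \<infinity>"
      by (rule le_less_trans) simp
    then show ?thesis
      by (auto simp: L2_def intro!: integrableI_bounded)
  qed
  obtain L where L: "\<And>m n. m \<ge> L \<Longrightarrow> n \<ge> L \<Longrightarrow> ip_norm (L2_inner M) (\<lambda>x. f m x - f n x) < 1"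
    using Cau[of 1] by auto
  have u: "u \<in> L2 M"
    using L2.diff_in[OF f[of L] diff[of 1 L L]] L by simp
  have "(\<lambda>n. ip_norm (L2_inner M) (\<lambda>x. f n x - u x)) \<longlonglongrightarrow> 0"
  proof (rule LIMSEQ_I)
    fix e :: real assume e: "0 < e"
    obtain L where L: "\<And>m n. m \<ge> L \<Longrightarrow> n \<ge> L \<Longrightarrow> ip_norm (L2_inner M) (\<lambda>x. f m x - f n x) < e / 2"
      using Cau[of "e / 2"] e by auto
    have "norm (ip_norm (L2_inner M) (\<lambda>x. f m x - u x) - 0) < e" if "m \<ge> L" for m
    proof -
      have "ennreal ((ip_norm (L2_inner M) (\<lambda>x. f m x - u x))\<^sup>2) \<le> ennreal ((e / 2)\<^sup>2)"
        using key[of "e / 2" L m] L[OF that] e by (simp add: L2_norm_sq L2.diff_in f u)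
      then have "(ip_norm (L2_inner M) (\<lambda>x. f m x - u x))\<^sup>2 \<le> (e / 2)\<^sup>2"
        by (rule iffD1[OF ennreal_le_iff, rotated]) simp
      then have "ip_norm (L2_inner M) (\<lambda>x. f m x - u x) \<le> e / 2"
        by (rule power2_le_imp_le) (use e in simp)
      then show ?thesis using e L2.nrm_nonneg[OF L2.diff_in[OF f[of m] u]] by simp
    qed
    then show "\<exists>L. \<forall>m\<ge>L. norm (ip_norm (L2_inner M) (\<lambda>x. f m x - u x) - 0) < e" by blast
  qed
  then show "\<exists>u\<in>L2 M. (\<lambda>n. ip_norm (L2_inner M) (\<lambda>x. f n x - u x)) \<longlonglongrightarrow> 0"
    using u by blast
qed

lemma L2_norm_cong_AE:
  assumes "f \<in> L2 M" "g \<in> L2 M" "AE x in M. f x = g x"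
  shows "ip_norm (L2_inner M) f = ip_norm (L2_inner M) g"
  using L2_inner_cong_AE[OF assms(1,1,2,2,3,3)] by (simp add: ip_norm_def)

lemma L2_norm_bounded_mult:
  assumes g: "g \<in> borel_measurable M" "AE x in M. norm (g x) \<le> C" and f: "f \<in> L2 M" and C: "0 \<le> C"
  shows "ip_norm (L2_inner M) (\<lambda>x. g x * f x) \<le> C * ip_norm (L2_inner M) f"
proof (rule power2_le_imp_le)
  have gf: "(\<lambda>x. g x * f x) \<in> L2 M" by (rule L2_bounded_mult[OF g f])
  have [measurable]: "f \<in> borel_measurable M" by (rule L2_measurable[OF f])
  have "ennreal ((ip_norm (L2_inner M) (\<lambda>x. g x * f x))\<^sup>2) = (\<integral>\<^sup>+x. ennreal ((norm (g x * f x))\<^sup>2) \<partial>M)"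
    by (rule L2_norm_sq[OF gf])
  also have "\<dots> \<le> (\<integral>\<^sup>+x. ennreal (C\<^sup>2) * ennreal ((norm (f x))\<^sup>2) \<partial>M)"
  proof (rule nn_integral_mono_AE)
    show "AE x in M. ennreal ((norm (g x * f x))\<^sup>2) \<le> ennreal (C\<^sup>2) * ennreal ((norm (f x))\<^sup>2)"
      using g(2)
    proof eventually_elim
      fix x assume "norm (g x) \<le> C"
      then have "(norm (g x * f x))\<^sup>2 \<le> C\<^sup>2 * (norm (f x))\<^sup>2"
        unfolding norm_mult power_mult_distrib by (intro mult_right_mono power_mono) simp_all
      then show "ennreal ((norm (g x * f x))\<^sup>2) \<le> ennreal (C\<^sup>2) * ennreal ((norm (f x))\<^sup>2)"
        by (subst ennreal_mult[symmetric]) (simp_all add: ennreal_leI)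
    qed
  qed
  also have "\<dots> = ennreal (C\<^sup>2) * ennreal ((ip_norm (L2_inner M) f)\<^sup>2)"
    unfolding L2_norm_sq[OF f] by (rule nn_integral_cmult) measurable
  also have "\<dots> = ennreal ((C * ip_norm (L2_inner M) f)\<^sup>2)"
    by (simp add: power_mult_distrib ennreal_mult)
  finally show "(ip_norm (L2_inner M) (\<lambda>x. g x * f x))\<^sup>2 \<le> (C * ip_norm (L2_inner M) f)\<^sup>2"
    by (rule iffD1[OF ennreal_le_iff, rotated]) simp
  show "0 \<le> C * ip_norm (L2_inner M) f"
    using C L2.nrm_nonneg[OF f] by simp
qed

text \<open>
  Spaces normed by finitely many \<open>L\<^sup>2\<close> norms of almost everywhere linear images; Sobolev spaces are
  of this kind with \<open>T\<close> running through the weak derivatives.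
\<close>

locale L2_family =
  fixes M :: "'x measure" and V :: "('x \<Rightarrow> complex) set" and I :: "'i set"
    and T :: "'i \<Rightarrow> ('x \<Rightarrow> complex) \<Rightarrow> 'x \<Rightarrow> complex"
  assumes fin: "finite I"
    and V_zero: "(\<lambda>_. 0) \<in> V"
    and V_add: "u \<in> V \<Longrightarrow> v \<in> V \<Longrightarrow> (\<lambda>x. u x + v x) \<in> V"
    and V_scale: "u \<in> V \<Longrightarrow> (\<lambda>x. c * u x) \<in> V"
    and T_L2: "i \<in> I \<Longrightarrow> u \<in> V \<Longrightarrow> T i u \<in> L2 M"
    and T_add: "i \<in> I \<Longrightarrow> u \<in> V \<Longrightarrow> v \<in> V \<Longrightarrow> AE x in M. T i (\<lambda>x. u x + v x) x = T i u x + T i v x"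
    and T_scale: "i \<in> I \<Longrightarrow> u \<in> V \<Longrightarrow> AE x in M. T i (\<lambda>x. c * u x) x = c * T i u x"
begin

definition fip :: "('x \<Rightarrow> complex) \<Rightarrow> ('x \<Rightarrow> complex) \<Rightarrow> complex" where
  "fip u v = (\<Sum>i\<in>I. L2_inner M (T i u) (T i v))"

lemma semi_inner_space_fip: "semi_inner_space V fip"
proof
  fix u v w :: "'x \<Rightarrow> complex" and c :: complex
  assume u: "u \<in> V"
  show "(\<lambda>x. c * u x) \<in> V" by (rule V_scale[OF u])
  show "0 \<le> Re (fip u u)"
    unfolding fip_def Re_sum by (intro sum_nonneg L2.ip_nonneg T_L2 u)
  {
    assume w: "w \<in> V"
    have "L2_inner M (T i (\<lambda>x. c * u x)) (T i w) = c * L2_inner M (T i u) (T i w)" if i: "i \<in> I" for i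
    proof -
      have "L2_inner M (T i (\<lambda>x. c * u x)) (T i w) = L2_inner M (\<lambda>x. c * T i u x) (T i w)"
        by (intro L2_inner_cong_AE T_L2 T_scale L2_scale V_scale i u w) simp
      then show ?thesis by (simp add: L2.ip_scale T_L2 i u w)
    qed
    then show "fip (\<lambda>x. c * u x) w = c * fip u w" by (simp add: fip_def sum_distrib_left)
    show "fip w u = cnj (fip u w)"
      unfolding fip_def cnj_sum by (intro sum.cong refl L2.ip_cnj T_L2 u w)
  }
  assume v: "v \<in> V"
  show "(\<lambda>x. u x + v x) \<in> V" by (rule V_add[OF u v])
  assume w: "w \<in> V"
  have "L2_inner M (T i (\<lambda>x. u x + v x)) (T i w) = L2_inner M (T i u) (T i w) + L2_inner M (T i v) (T i w)"
    if i: "i \<in> I" for i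
  proof -
    have "L2_inner M (T i (\<lambda>x. u x + v x)) (T i w) = L2_inner M (\<lambda>x. T i u x + T i v x) (T i w)"
      by (intro L2_inner_cong_AE T_L2 T_add L2_add V_add i u v w) simp
    then show ?thesis by (simp add: L2.ip_add T_L2 i u v w)
  qed
  then show "fip (\<lambda>x. u x + v x) w = fip u w + fip v w" by (simp add: fip_def sum.distrib)
qed (rule V_zero)

sublocale semi_inner_space V fip
  by (rule semi_inner_space_fip)

lemma T_diff:
  assumes "i \<in> I" "u \<in> V" "v \<in> V"
  shows "AE x in M. T i (\<lambda>x. u x - v x) x = T i u x - T i v x"
  using T_add[OF assms(1,2) V_scale[OF assms(3), of "-1"]] T_scale[OF assms(1,3), of "-1"]
  by eventually_elim simp

lemma nrm_sq_sum:
  assumes "u \<in> V" shows "(ip_norm fip u)\<^sup>2 = (\<Sum>i\<in>I. (ip_norm (L2_inner M) (T i u))\<^sup>2)"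
  unfolding nrm_sq[OF assms] by (simp add: fip_def L2.nrm_sq T_L2 assms)

lemma component_le:
  assumes "i \<in> I" "u \<in> V"
  shows "ip_norm (L2_inner M) (T i u) \<le> ip_norm fip u"
proof (rule power2_le_imp_le)
  show "(ip_norm (L2_inner M) (T i u))\<^sup>2 \<le> (ip_norm fip u)\<^sup>2"
    unfolding nrm_sq_sum[OF assms(2)] by (rule member_le_sum[OF assms(1) _ fin]) simp
qed (rule nrm_nonneg[OF assms(2)])

lemma component_diff:
  assumes "i \<in> I" "u \<in> V" "v \<in> V"
  shows "ip_norm (L2_inner M) (T i (\<lambda>x. u x - v x)) = ip_norm (L2_inner M) (\<lambda>x. T i u x - T i v x)"
  by (intro L2_norm_cong_AE T_L2 T_diff L2.diff_in diff_in assms)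

lemma tendsto_if_components:
  assumes f: "\<And>n. f n \<in> V" and u: "u \<in> V"
    and conv: "\<And>i. i \<in> I \<Longrightarrow> (\<lambda>n. ip_norm (L2_inner M) (\<lambda>x. T i (f n) x - T i u x)) \<longlonglongrightarrow> 0"
  shows "(\<lambda>n. ip_norm fip (\<lambda>x. f n x - u x)) \<longlonglongrightarrow> 0"
proof -
  have "(ip_norm fip (\<lambda>x. f n x - u x))\<^sup>2 = (\<Sum>i\<in>I. (ip_norm (L2_inner M) (\<lambda>x. T i (f n) x - T i u x))\<^sup>2)" for n
    unfolding nrm_sq_sum[OF diff_in[OF f u]] by (intro sum.cong refl) (simp add: component_diff[OF _ f u])
  moreover have "(\<lambda>n. \<Sum>i\<in>I. (ip_norm (L2_inner M) (\<lambda>x. T i (f n) x - T i u x))\<^sup>2) \<longlonglongrightarrow> (\<Sum>i\<in>I. 0\<^sup>2)"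
    by (intro tendsto_sum tendsto_power conv)
  ultimately have "(\<lambda>n. (ip_norm fip (\<lambda>x. f n x - u x))\<^sup>2) \<longlonglongrightarrow> 0" by simp
  then have "(\<lambda>n. sqrt ((ip_norm fip (\<lambda>x. f n x - u x))\<^sup>2)) \<longlonglongrightarrow> sqrt 0" by (rule tendsto_real_sqrt)
  then show ?thesis by (simp add: nrm_nonneg[OF diff_in[OF f u]])
qed

lemma complete_if_closed:
  assumes closed: "\<And>f g. \<lbrakk>\<And>n. f n \<in> V; \<And>i. i \<in> I \<Longrightarrow> g i \<in> L2 M;
      \<And>i. i \<in> I \<Longrightarrow> (\<lambda>n. ip_norm (L2_inner M) (\<lambda>x. T i (f n) x - g i x)) \<longlonglongrightarrow> 0\<rbrakk>
      \<Longrightarrow> \<exists>u\<in>V. \<forall>i\<in>I. AE x in M. T i u x = g i x"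
  shows "ip_complete V fip"
  unfolding ip_complete_def
proof (intro allI impI)
  fix f assume "ip_Cauchy V fip f"
  then have f: "\<And>n. f n \<in> V"
    and Cau: "\<And>e. 0 < e \<Longrightarrow> \<exists>N. \<forall>m\<ge>N. \<forall>n\<ge>N. ip_norm fip (\<lambda>x. f m x - f n x) < e"
    by (auto simp: ip_Cauchy_def)
  have "\<exists>g\<in>L2 M. (\<lambda>n. ip_norm (L2_inner M) (\<lambda>x. T i (f n) x - g x)) \<longlonglongrightarrow> 0" if i: "i \<in> I" for i
  proof -
    have le: "ip_norm (L2_inner M) (\<lambda>x. T i (f m) x - T i (f n) x) \<le> ip_norm fip (\<lambda>x. f m x - f n x)" for m n
      using component_le[OF i diff_in[OF f f], of m n] component_diff[OF i f f, of m n] by simp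
    have "ip_Cauchy (L2 M) (L2_inner M) (\<lambda>n. T i (f n))"
      unfolding ip_Cauchy_def
    proof (intro conjI allI impI T_L2 i f)
      fix e :: real assume "0 < e"
      then obtain N where "\<forall>m\<ge>N. \<forall>n\<ge>N. ip_norm fip (\<lambda>x. f m x - f n x) < e" using Cau by blast
      then show "\<exists>N. \<forall>m\<ge>N. \<forall>n\<ge>N. ip_norm (L2_inner M) (\<lambda>x. T i (f m) x - T i (f n) x) < e"
        using le le_less_trans by blast
    qed
    then show ?thesis using L2_complete unfolding ip_complete_def by blast
  qed
  then obtain g where g: "\<And>i. i \<in> I \<Longrightarrow> g i \<in> L2 M"
    "\<And>i. i \<in> I \<Longrightarrow> (\<lambda>n. ip_norm (L2_inner M) (\<lambda>x. T i (f n) x - g i x)) \<longlonglongrightarrow> 0" by metis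
  obtain u where u: "u \<in> V" "\<And>i. i \<in> I \<Longrightarrow> AE x in M. T i u x = g i x"
    using closed[OF f g] by blast
  have "(\<lambda>n. ip_norm fip (\<lambda>x. f n x - u x)) \<longlonglongrightarrow> 0"
  proof (rule tendsto_if_components[OF f u(1)])
    fix i assume i: "i \<in> I"
    have "ip_norm (L2_inner M) (\<lambda>x. T i (f n) x - T i u x) = ip_norm (L2_inner M) (\<lambda>x. T i (f n) x - g i x)" for n
    proof (rule L2_norm_cong_AE)
      show "AE x in M. T i (f n) x - T i u x = T i (f n) x - g i x"
        using u(2)[OF i] by eventually_elim simp
    qed (intro L2.diff_in T_L2 g i f u)+
    then show "(\<lambda>n. ip_norm (L2_inner M) (\<lambda>x. T i (f n) x - T i u x)) \<longlonglongrightarrow> 0"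
      using g(2)[OF i] by simp
  qed
  then show "\<exists>u\<in>V. (\<lambda>n. ip_norm fip (\<lambda>x. f n x - u x)) \<longlonglongrightarrow> 0" using u(1) by blast
qed

end

section \<open>Weak derivatives\<close>

text \<open>
  Testing with bump functions shows that the integral over every small cube vanishes; differentiate
  the integral.
\<close>

lemma fundamental_lemma_of_variations:
  fixes f :: "'a::euclidean_space \<Rightarrow> complex"
  assumes D: "open D" and f: "integrable (lebesgue_on D) f"
    and zero: "\<And>\<phi>. test_function D \<phi> \<Longrightarrow> (\<integral>x. f x * \<phi> x \<partial>lebesgue_on D) = 0"
  shows "AE x in lebesgue_on D. f x = 0"
proof -
  have DS: "D \<inter> space lebesgue \<in> sets lebesgue" using D by auto
  define g where "g x = indicator D x *\<^sub>R f x" for x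
  have g: "integrable lebesgue g"
    using f unfolding g_def[abs_def] by (simp add: integrable_restrict_space[OF DS])
  have [measurable]: "g \<in> borel_measurable lebesgue" "box a b \<in> sets lebesgue" "cbox a b \<in> sets lebesgue" for a b :: 'a
    using borel_measurable_integrable[OF g] by auto
  have cube: "integral (cbox a b) g = 0" if sub: "cbox a b \<subseteq> D" for a b
  proof -
    have "(\<integral>x. indicator (cbox a b) x *\<^sub>R g x \<partial>lebesgue) = (\<integral>x. indicator (box a b) x * g x \<partial>lebesgue)"
    proof (rule integral_cong_AE)
      have "AE x in lebesgue. x \<notin> cbox a b - box a b"
        using negligible_frontier_interval[of a b] by (auto simp: negligible_iff_null_sets AE_iff_null_sets eventually_ae_filter)
      then show "AE x in lebesgue. indicator (cbox a b) x *\<^sub>R g x = indicator (box a b) x * g x"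
        by eventually_elim (use box_subset_cbox[of a b] in \<open>auto split: split_indicator\<close>)
    qed measurable
    also have "\<dots> = 0"
    proof (rule LIMSEQ_unique)
      show "(\<lambda>m. \<integral>x. bump a b m x * g x \<partial>lebesgue) \<longlonglongrightarrow> (\<integral>x. indicator (box a b) x * g x \<partial>lebesgue)"
      proof (rule integral_dominated_convergence)
        show "integrable lebesgue (\<lambda>x. norm (g x))" using g by simp
        show "AE x in lebesgue. (\<lambda>m. bump a b m x * g x) \<longlonglongrightarrow> indicator (box a b) x * g x"
          by (intro AE_I2 tendsto_intros bump_tendsto)
        show "AE x in lebesgue. norm (bump a b m x * g x) \<le> norm (g x)" for m
          using norm_bump_le_1[of a b m] by (auto simp: norm_mult intro!: mult_left_le_one_le)
        show "(\<lambda>x. bump a b m x * g x) \<in> borel_measurable lebesgue" for m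
        proof (rule borel_measurable_times)
          have "continuous_on UNIV (bump a b m)"
            using smooth_bump[of a b m] Ck_imp_continuous by (auto simp: smooth_def)
          then show "bump a b m \<in> borel_measurable lebesgue"
            by (intro measurable_completion) (simp add: borel_measurable_continuous_onI)
        qed measurable
      qed measurable
      have "(\<integral>x. bump a b m x * g x \<partial>lebesgue) = 0" for m
      proof -
        have "(\<integral>x. bump a b m x * g x \<partial>lebesgue) = (\<integral>x. f x * bump a b m x \<partial>lebesgue_on D)"
          by (simp add: integral_restrict_space[OF DS] g_def mult.commute scaleR_conv_of_real mult_ac)
        then show ?thesis using zero[OF test_function_bump[OF sub]] by simp
      qed
      then show "(\<lambda>m. \<integral>x. bump a b m x * g x \<partial>lebesgue) \<longlonglongrightarrow> 0" by simp
    qed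
    finally have "(LINT x:cbox a b|lebesgue. g x) = 0" by (simp add: set_lebesgue_integral_def)
    moreover have "set_integrable lebesgue (cbox a b) g"
      unfolding set_integrable_def using g by (intro integrable_mult_indicator) measurable
    ultimately show ?thesis by (simp add: set_lebesgue_integral_eq_integral)
  qed
  have "g integrable_on cbox a b" for a b
    using integrable_on_subcbox[OF integrable_on_lebesgue[OF g]] by simp
  then obtain N where N: "negligible N"
    and diff: "\<And>x e. \<lbrakk>x \<notin> N; 0 < e\<rbrakk> \<Longrightarrow> \<exists>d>0. \<forall>h. 0 < h \<and> h < d \<longrightarrow>
      norm (integral (cbox x (x + h *\<^sub>R One)) g /\<^sub>R h ^ DIM('a) - g x) < e"
    using integrable_ccontinuous_explicit[of g] by blast
  have "g x = 0" if x: "x \<in> D" "x \<notin> N" for x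
  proof (rule ccontr)
    assume "g x \<noteq> 0"
    then obtain d where d: "0 < d" "\<And>h. \<lbrakk>0 < h; h < d\<rbrakk> \<Longrightarrow>
        norm (integral (cbox x (x + h *\<^sub>R One)) g /\<^sub>R h ^ DIM('a) - g x) < norm (g x)"
      using diff[OF x(2), of "norm (g x)"] by auto
    obtain r where r: "0 < r" "cball x r \<subseteq> D"
      using D x(1) open_contains_cball by blast
    define h where "h = min (d / 2) (r / DIM('a))"
    have h: "0 < h" "h < d" "h * DIM('a) \<le> r"
      using d(1) r(1) DIM_positive[where 'a='a] by (auto simp: h_def min_def field_simps)
    have "cbox x (x + h *\<^sub>R One) \<subseteq> D"
    proof
      fix y assume y: "y \<in> cbox x (x + h *\<^sub>R One)"
      have "norm (y - x) \<le> (\<Sum>b\<in>Basis. \<bar>(y - x) \<bullet> b\<bar>)" by (rule norm_le_l1)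
      also have "\<dots> \<le> (\<Sum>b\<in>(Basis::'a set). h)"
        using y by (intro sum_mono) (fastforce simp: mem_box inner_diff_left inner_add_left)
      also have "\<dots> \<le> r" using h by (simp add: mult.commute)
      finally show "y \<in> D" using r by (auto simp: dist_norm norm_minus_commute)
    qed
    from cube[OF this] d(2)[OF h(1,2)] show False by simp
  qed
  moreover have "AE x in lebesgue. x \<notin> N"
    using N by (simp add: negligible_iff_null_sets AE_not_in)
  ultimately have "AE x in lebesgue. x \<in> D \<longrightarrow> f x = 0"
    by (auto simp: g_def elim!: eventually_mono)
  then show ?thesis by (simp add: AE_restrict_space_iff[OF DS])
qed

lemma integral_lborel_translation:
  fixes f :: "'a::euclidean_space \<Rightarrow> complex"
  assumes [measurable]: "f \<in> borel_measurable borel"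
  shows "(\<integral>x. f (a + x) \<partial>lborel) = (\<integral>x. f x \<partial>lborel)"
proof -
  have "(\<integral>x. f x \<partial>lborel) = (\<integral>x. f x \<partial>distr lborel borel (\<lambda>x. a + x))"
    by (simp add: lborel_distr_plus)
  also have "\<dots> = (\<integral>x. f (a + x) \<partial>lborel)"
    by (rule integral_distr) measurable
  finally show ?thesis by simp
qed

text \<open>The difference quotients have integral zero by translation invariance.\<close>

lemma integral_frechet_derivative_compact_support:
  fixes f :: "'a::euclidean_space \<Rightarrow> complex"
  assumes C1: "Ck 1 f" and supp: "bounded {x. f x \<noteq> 0}"
  shows "(\<integral>x. frechet_derivative f (at x) v \<partial>lborel) = 0"
proof -
  let ?f' = "\<lambda>x. frechet_derivative f (at x)"
  have der: "(f has_derivative ?f' x) (at x)" for x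
    using C1 by (simp add: frechet_derivative_works[symmetric])
  have cont: "continuous_on UNIV f" by (rule Ck_imp_continuous[OF C1])
  have cont': "continuous_on UNIV (\<lambda>x. ?f' x v)" using C1 by simp
  have [measurable]: "f \<in> borel_measurable borel" "(\<lambda>x. ?f' x v) \<in> borel_measurable borel"
    using cont cont' by (auto intro: borel_measurable_continuous_onI)
  obtain R where R: "0 < R" "\<And>x. f x \<noteq> 0 \<Longrightarrow> norm x \<le> R"
    using supp bounded_pos by (metis (mono_tags, lifting) mem_Collect_eq)
  define K where "K = cball (0::'a) (R + norm v)"
  have "compact K" by (simp add: K_def)
  then have "bounded ((\<lambda>x. ?f' x v) ` K)"
    using cont' by (intro compact_imp_bounded compact_continuous_image) (auto intro: continuous_on_subset)
  then obtain B where B: "0 < B" "\<And>x. x \<in> K \<Longrightarrow> norm (?f' x v) \<le> B"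
    unfolding bounded_pos by auto
  have f0: "?f' x v = 0" if "norm x > R" for x
  proof -
    have "((\<lambda>_. 0) has_derivative (\<lambda>_. 0)) (at x)" by simp
    then have "(f has_derivative (\<lambda>_. 0)) (at x)"
      by (rule has_derivative_transform_within_open[where s = "- cball 0 R"])
        (use that R in \<open>auto simp: not_le\<close>, fastforce)
    then have "?f' x = (\<lambda>_. 0)" using frechet_derivative_at by metis
    then show ?thesis by simp
  qed
  have B': "norm (?f' x v) \<le> B" for x
  proof (cases "x \<in> K")
    case False
    then have "\<not> norm x \<le> R + norm v" by (simp add: K_def)
    then have "norm x > R" using norm_ge_zero[of v] by linarith
    then show ?thesis using f0 B(1) by simp
  qed (rule B(2))
  have line: "norm (f (x + t *\<^sub>R v) - f x) \<le> t * B" if "0 \<le> t" for x t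
  proof -
    have "norm (f (x + t *\<^sub>R v) - f (x + 0 *\<^sub>R v)) \<le> B * norm (t - 0)"
    proof (rule differentiable_bound[where S = "{0..t}" and f' = "\<lambda>s h. ?f' (x + s *\<^sub>R v) (h *\<^sub>R v)"])
      fix s assume "s \<in> {0..t}"
      have "((\<lambda>s. x + s *\<^sub>R v) has_derivative (\<lambda>h. h *\<^sub>R v)) (at s within {0..t})"
        by (auto intro!: derivative_eq_intros)
      then show "((\<lambda>s. f (x + s *\<^sub>R v)) has_derivative (\<lambda>h. ?f' (x + s *\<^sub>R v) (h *\<^sub>R v))) (at s within {0..t})"
        by (rule has_derivative_compose) (rule der)
      have "?f' (x + s *\<^sub>R v) (h *\<^sub>R v) = h *\<^sub>R ?f' (x + s *\<^sub>R v) v" for h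
        using has_derivative_bounded_linear[OF der] by (simp add: linear_cmul bounded_linear.linear)
      then show "onorm (\<lambda>h. ?f' (x + s *\<^sub>R v) (h *\<^sub>R v)) \<le> B"
        using B' B(1) by (intro onorm_le) (simp add: mult.commute[of B] mult_left_mono)
    qed (use that in auto)
    then show ?thesis using that by (simp add: mult.commute)
  qed
  define q where "q n x = of_real (real (Suc n)) * (f ((1 / real (Suc n)) *\<^sub>R v + x) - f x)" for n x
  have int_f: "integrable lborel (\<lambda>x. f (a + x))" for a
  proof -
    obtain C where C: "0 < C" "\<And>x. x \<in> cball 0 R \<Longrightarrow> norm (f x) \<le> C"
      using compact_imp_bounded[OF compact_continuous_image[OF continuous_on_subset[OF cont]], of "cball 0 R"]
      unfolding bounded_pos by auto
    have "integrable lborel (\<lambda>x. indicator (cball (- a) R) x *\<^sub>R C)"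
      by (intro integrable_scaleR_left integrable_real_indicator) (auto simp: emeasure_bounded_finite[unfolded infinity_ennreal_def])
    then show ?thesis
    proof (rule Bochner_Integration.integrable_bound)
      show "AE x in lborel. norm (f (a + x)) \<le> norm (indicator (cball (- a) R) x *\<^sub>R C)"
      proof (rule AE_I2)
        fix x
        show "norm (f (a + x)) \<le> norm (indicator (cball (- a) R) x *\<^sub>R C)"
          using C R(2)[of "a + x"]
          by (cases "f (a + x) = 0") (auto simp: dist_norm norm_minus_commute add.commute split: split_indicator)
      qed
    qed measurable
  qed
  have q0: "(\<integral>x. q n x \<partial>lborel) = 0" for n
  proof -
    have "(\<integral>x. f ((1 / real (Suc n)) *\<^sub>R v + x) \<partial>lborel) = (\<integral>x. f x \<partial>lborel)"
      by (rule integral_lborel_translation) measurable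
    then show ?thesis
      unfolding q_def using int_f[of "(1 / real (Suc n)) *\<^sub>R v"] int_f[of 0] by simp
  qed
  have "(\<lambda>n. \<integral>x. q n x \<partial>lborel) \<longlonglongrightarrow> (\<integral>x. ?f' x v \<partial>lborel)"
  proof (rule integral_dominated_convergence)
    show "integrable lborel (\<lambda>x. indicator K x *\<^sub>R B)"
      by (intro integrable_scaleR_left integrable_real_indicator) (auto simp: K_def emeasure_bounded_finite[unfolded infinity_ennreal_def])
    show "AE x in lborel. (\<lambda>n. q n x) \<longlonglongrightarrow> ?f' x v"
    proof (rule AE_I2)
      fix x
      have "((\<lambda>t. x + t *\<^sub>R v) has_vector_derivative v) (at 0)"
        by (auto intro!: derivative_eq_intros)
      moreover have "(f has_derivative ?f' x) (at (x + 0 *\<^sub>R v) within range (\<lambda>t. x + t *\<^sub>R v))"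
        using der by (simp add: has_derivative_at_withinI)
      ultimately have "((\<lambda>t. f (x + t *\<^sub>R v)) has_vector_derivative ?f' x v) (at 0)"
        using vector_derivative_diff_chain_within[of "\<lambda>t. x + t *\<^sub>R v" v 0 UNIV f "?f' x"] by (simp add: o_def)
      then have "((\<lambda>h. norm (f (x + h *\<^sub>R v) - f x - h *\<^sub>R ?f' x v) / norm h) \<longlongrightarrow> 0) (at 0)"
        by (simp add: has_vector_derivative_def has_derivative_iff_norm)
      moreover have "norm (a - h *\<^sub>R w) / norm h = norm (a /\<^sub>R h - w)" if "h \<noteq> 0" for a w :: complex and h
      proof -
        have "a /\<^sub>R h - w = (a - h *\<^sub>R w) /\<^sub>R h" using that by (simp add: scaleR_diff_right)
        then show ?thesis by (simp add: divide_inverse mult.commute)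
      qed
      then have "\<forall>\<^sub>F h in at 0. norm (f (x + h *\<^sub>R v) - f x - h *\<^sub>R ?f' x v) / norm h
          = norm ((f (x + h *\<^sub>R v) - f x) /\<^sub>R h - ?f' x v)"
        by (simp add: eventually_at_filter)
      ultimately have "((\<lambda>h. norm ((f (x + h *\<^sub>R v) - f x) /\<^sub>R h - ?f' x v)) \<longlongrightarrow> 0) (at 0)"
        by (rule Lim_transform_eventually)
      then have "((\<lambda>h. (f (x + h *\<^sub>R v) - f x) /\<^sub>R h) \<longlongrightarrow> ?f' x v) (at 0)"
        by (rule LIM_zero_cancel[OF tendsto_norm_zero_cancel])
      moreover have "filterlim (\<lambda>n. 1 / real (Suc n)) (at 0) sequentially"
        by (intro filterlim_atI LIMSEQ_Suc lim_1_over_n) auto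
      ultimately have "(\<lambda>n. (f (x + (1 / real (Suc n)) *\<^sub>R v) - f x) /\<^sub>R (1 / real (Suc n))) \<longlonglongrightarrow> ?f' x v"
        by (rule filterlim_compose)
      then show "(\<lambda>n. q n x) \<longlonglongrightarrow> ?f' x v"
        by (simp add: q_def scaleR_conv_of_real add.commute)
    qed
    show "AE x in lborel. norm (q n x) \<le> indicator K x *\<^sub>R B" for n
    proof (rule AE_I2)
      fix x
      have tv: "norm ((1 / real (Suc n)) *\<^sub>R v) \<le> norm v"
        by (simp add: divide_le_eq mult_left_le_one_le) (simp add: field_simps)?
      show "norm (q n x) \<le> indicator K x *\<^sub>R B"
      proof (cases "x \<in> K")
        case True
        have "norm (q n x) \<le> real (Suc n) * (1 / real (Suc n) * B)"
          unfolding q_def norm_mult norm_of_real using line[of "1 / real (Suc n)" x]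
          by (intro mult_mono) (auto simp: add.commute)
        then show ?thesis using True by simp
      next
        case False
        then have "norm x > R + norm v" by (simp add: K_def)
        moreover from this have "norm ((1 / real (Suc n)) *\<^sub>R v + x) > R"
          using tv norm_triangle_ineq4[of "(1 / real (Suc n)) *\<^sub>R v + x" "(1 / real (Suc n)) *\<^sub>R v"] by simp
        ultimately have "f x = 0" "f ((1 / real (Suc n)) *\<^sub>R v + x) = 0"
          using R(2)[of x] R(2)[of "(1 / real (Suc n)) *\<^sub>R v + x"] norm_ge_zero[of v] by fastforce+
        then show ?thesis using False by (simp add: q_def)
      qed
    qed
  qed (auto simp: q_def)
  then show ?thesis by (simp add: q0 LIMSEQ_const_iff)
qed

lemma frechet_derivative_outside_support:
  assumes "x \<notin> closure {x. \<phi> x \<noteq> 0}"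
  shows "frechet_derivative \<phi> (at x) v = 0"
proof -
  have "((\<lambda>_. 0) has_derivative (\<lambda>_. 0)) (at x)" by simp
  then have "(\<phi> has_derivative (\<lambda>_. 0)) (at x)"
    by (rule has_derivative_transform_within_open[where s = "- closure {x. \<phi> x \<noteq> 0}"])
      (use assms closure_subset[of "{x. \<phi> x \<noteq> 0}"] in auto)
  then have "frechet_derivative \<phi> (at x) = (\<lambda>_. 0)" using frechet_derivative_at by metis
  then show ?thesis by simp
qed

lemma test_function_mono_support:
  assumes "test_function D \<phi>" "smooth \<psi>" "{x. \<psi> x \<noteq> 0} \<subseteq> closure {x. \<phi> x \<noteq> 0}"
  shows "test_function D \<psi>"
proof -
  have "closure {x. \<psi> x \<noteq> 0} \<subseteq> closure {x. \<phi> x \<noteq> 0}"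
    using assms(3) by (intro closure_minimal) auto
  then show ?thesis
    using assms(1,2) compact_closure bounded_subset
    by (auto simp: test_function_def compact_eq_bounded_closed)
qed

lemma test_function_frechet_derivative:
  assumes "test_function D \<phi>"
  shows "test_function D (\<lambda>x. frechet_derivative \<phi> (at x) v)"
proof (rule test_function_mono_support[OF assms])
  have "Ck (Suc m) \<phi>" for m using assms by (simp add: test_function_def smooth_def)
  then show "smooth (\<lambda>x. frechet_derivative \<phi> (at x) v)" by (simp add: smooth_def)
  show "{x. frechet_derivative \<phi> (at x) v \<noteq> 0} \<subseteq> closure {x. \<phi> x \<noteq> 0}"
    using frechet_derivative_outside_support by blast
qed

lemma test_function_scale:
  assumes "test_function D \<phi>" shows "test_function D (\<lambda>x. c * \<phi> x)"
proof (rule test_function_mono_support[OF assms])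
  show "smooth (\<lambda>x. c * \<phi> x)"
    using assms by (auto simp: test_function_def smooth_def intro: Ck_mult Ck_const)
  show "{x. c * \<phi> x \<noteq> 0} \<subseteq> closure {x. \<phi> x \<noteq> 0}"
    using closure_subset[of "{x. \<phi> x \<noteq> 0}"] by auto
qed

lemma test_function_add:
  assumes "test_function D \<phi>" "test_function D \<psi>"
  shows "test_function D (\<lambda>x. \<phi> x + \<psi> x)"
proof -
  have "closure {x. \<phi> x + \<psi> x \<noteq> 0} \<subseteq> closure ({x. \<phi> x \<noteq> 0} \<union> {x. \<psi> x \<noteq> 0})"
    by (intro closure_mono) auto
  then have sub: "closure {x. \<phi> x + \<psi> x \<noteq> 0} \<subseteq> closure {x. \<phi> x \<noteq> 0} \<union> closure {x. \<psi> x \<noteq> 0}"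
    by (simp add: closure_Un)
  have "bounded (closure {x. \<phi> x \<noteq> 0} \<union> closure {x. \<psi> x \<noteq> 0})"
    using assms by (simp add: test_function_def compact_imp_bounded)
  then have "bounded (closure {x. \<phi> x + \<psi> x \<noteq> 0})" using sub by (rule bounded_subset)
  moreover have "closure {x. \<phi> x + \<psi> x \<noteq> 0} \<subseteq> D"
    using sub assms unfolding test_function_def by blast
  ultimately show ?thesis
    using assms by (auto simp: test_function_def smooth_def compact_eq_bounded_closed intro: Ck_add)
qed

lemma test_function_zero: "test_function D (\<lambda>x. 0)"
  by (simp add: test_function_def smooth_def Ck_const)

lemma test_function_continuous: "test_function D \<phi> \<Longrightarrow> continuous_on UNIV \<phi>"
  using Ck_imp_continuous by (auto simp: test_function_def smooth_def)

lemma test_function_eq_0: "test_function D \<phi> \<Longrightarrow> x \<notin> D \<Longrightarrow> \<phi> x = 0"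
  using closure_subset[of "{x. \<phi> x \<noteq> 0}"] by (auto simp: test_function_def)

lemma test_function_bounded:
  assumes "test_function D \<phi>"
  obtains C where "\<And>x. norm (\<phi> x) \<le> C"
proof -
  have "bounded (\<phi> ` closure {x. \<phi> x \<noteq> 0})"
    using assms continuous_on_subset[OF test_function_continuous[OF assms]]
    by (intro compact_imp_bounded compact_continuous_image) (auto simp: test_function_def)
  then obtain C where C: "0 < C" "\<And>x. x \<in> closure {x. \<phi> x \<noteq> 0} \<Longrightarrow> norm (\<phi> x) \<le> C"
    unfolding bounded_pos by auto
  have "norm (\<phi> x) \<le> C" for x
    using C closure_subset[of "{x. \<phi> x \<noteq> 0}"] by (cases "\<phi> x = 0") auto
  then show thesis by (rule that)
qed

lemma is_weak_partial_zero: "is_weak_partial D b (\<lambda>x. 0) (\<lambda>x. 0)"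
  by (simp add: is_weak_partial_def L2_zero)

lemma weak_partial_spec:
  assumes "u \<in> H1 D" "b \<in> Basis"
  shows "is_weak_partial D b u (weak_partial D b u)"
proof -
  have "\<exists>v. is_weak_partial D b u v" using assms by (simp add: H1_def)
  then show ?thesis unfolding weak_partial_def by (rule someI_ex)
qed

lemma H1_L2: "u \<in> H1 D \<Longrightarrow> u \<in> L2 (lebesgue_on D)"
  by (simp add: H1_def)

lemma weak_partial_L2: "u \<in> H1 D \<Longrightarrow> b \<in> Basis \<Longrightarrow> weak_partial D b u \<in> L2 (lebesgue_on D)"
  using weak_partial_spec by (auto simp: is_weak_partial_def)

lemma H2_H1: "u \<in> H2 D \<Longrightarrow> u \<in> H1 D"
  by (simp add: H2_def)

lemma weak_partial_H1: "u \<in> H2 D \<Longrightarrow> b \<in> Basis \<Longrightarrow> weak_partial D b u \<in> H1 D"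
  by (simp add: H2_def)

locale bounded_domain =
  fixes D :: "'a::euclidean_space set"
  assumes open_D: "open D" and bounded_D: "bounded D"
begin

abbreviation "M \<equiv> lebesgue_on D"

lemma D_sets: "D \<inter> space lebesgue \<in> sets lebesgue"
  using open_D by auto

lemma finite_measure_M: "finite_measure M"
  by (intro finite_measure_lebesgue_on lmeasurable_open bounded_D open_D)

lemma L2_integrable: "f \<in> L2 M \<Longrightarrow> integrable M f"
proof -
  interpret finite_measure M by (rule finite_measure_M)
  assume f: "f \<in> L2 M"
  have "(\<lambda>x. 1) \<in> L2 M" by (simp add: L2_def)
  from L2_mult_integrable[OF f this] show ?thesis by simp
qed

lemma test_function_L2:
  assumes \<phi>: "test_function D \<phi>" shows "\<phi> \<in> L2 M"
proof -
  interpret finite_measure M by (rule finite_measure_M)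
  obtain C where C: "\<And>x. norm (\<phi> x) \<le> C" using test_function_bounded[OF \<phi>] by blast
  have "\<phi> \<in> borel_measurable lebesgue"
    using test_function_continuous[OF \<phi>]
    by (intro measurable_completion) (simp add: borel_measurable_continuous_onI)
  then have "\<phi> \<in> borel_measurable M" by (rule measurable_restrict_space1)
  moreover have "(\<lambda>x. 1) \<in> L2 M" by (simp add: L2_def)
  ultimately show ?thesis using L2_bounded_mult[of \<phi> M C "\<lambda>x. 1"] C by simp
qed

lemma integral_frechet_derivative_test_function:
  assumes \<phi>: "test_function D \<phi>"
  shows "(\<integral>x. frechet_derivative \<phi> (at x) v \<partial>M) = 0"
proof -
  let ?d = "\<lambda>x. frechet_derivative \<phi> (at x) v"
  have d: "test_function D ?d" by (rule test_function_frechet_derivative[OF \<phi>])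
  have "(\<integral>x. ?d x \<partial>M) = (\<integral>x. indicator D x *\<^sub>R ?d x \<partial>lebesgue)"
    by (rule integral_restrict_space[OF D_sets])
  also have "\<dots> = (\<integral>x. ?d x \<partial>lebesgue)"
    using test_function_eq_0[OF d] by (intro Bochner_Integration.integral_cong) (auto split: split_indicator)
  also have "\<dots> = (\<integral>x. ?d x \<partial>lborel)"
    using test_function_continuous[OF d] by (intro integral_completion) (simp add: borel_measurable_continuous_onI)
  also have "\<dots> = 0"
  proof (rule integral_frechet_derivative_compact_support)
    show "Ck 1 \<phi>" using \<phi> by (simp only: test_function_def smooth_def)
    show "bounded {x. \<phi> x \<noteq> 0}"
      using \<phi> closure_subset by (auto simp: test_function_def intro: bounded_subset dest: compact_imp_bounded)
  qed
  finally show ?thesis .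
qed

lemma is_weak_partial_test_function:
  assumes \<phi>: "test_function D \<phi>"
  shows "is_weak_partial D b \<phi> (\<lambda>x. frechet_derivative \<phi> (at x) b)"
  unfolding is_weak_partial_def
proof (intro conjI allI impI)
  show "\<phi> \<in> L2 M" by (rule test_function_L2[OF \<phi>])
  show d: "(\<lambda>x. frechet_derivative \<phi> (at x) b) \<in> L2 M"
    by (intro test_function_L2 test_function_frechet_derivative \<phi>)
  fix \<psi> assume \<psi>: "test_function D \<psi>"
  have "test_function D (\<lambda>x. \<phi> x * \<psi> x)"
  proof (rule test_function_mono_support[OF \<phi>])
    show "smooth (\<lambda>x. \<phi> x * \<psi> x)"
      using \<phi> \<psi> by (auto simp: test_function_def smooth_def intro: Ck_mult)
    show "{x. \<phi> x * \<psi> x \<noteq> 0} \<subseteq> closure {x. \<phi> x \<noteq> 0}"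
      using closure_subset[of "{x. \<phi> x \<noteq> 0}"] by auto
  qed
  from integral_frechet_derivative_test_function[OF this, of b]
  have "(\<integral>x. frechet_derivative (\<lambda>x. \<phi> x * \<psi> x) (at x) b \<partial>M) = 0" .
  moreover have "frechet_derivative (\<lambda>x. \<phi> x * \<psi> x) (at x) b =
      \<phi> x * frechet_derivative \<psi> (at x) b + frechet_derivative \<phi> (at x) b * \<psi> x" for x
  proof -
    have "Ck 1 \<phi>" "Ck 1 \<psi>" using \<phi> \<psi> by (simp_all only: test_function_def smooth_def)
    then have "\<phi> differentiable at x" "\<psi> differentiable at x" by simp_all
    then have "((\<lambda>x. \<phi> x * \<psi> x) has_derivative
      (\<lambda>v. \<phi> x * frechet_derivative \<psi> (at x) v + frechet_derivative \<phi> (at x) v * \<psi> x)) (at x)"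
      by (intro has_derivative_mult) (simp_all add: frechet_derivative_works[symmetric])
    from frechet_derivative_at[OF this] show ?thesis by metis
  qed
  ultimately have "(\<integral>x. \<phi> x * frechet_derivative \<psi> (at x) b + frechet_derivative \<phi> (at x) b * \<psi> x \<partial>M) = 0"
    by simp
  moreover have "integrable M (\<lambda>x. \<phi> x * frechet_derivative \<psi> (at x) b)"
    "integrable M (\<lambda>x. frechet_derivative \<phi> (at x) b * \<psi> x)"
    by (intro L2_mult_integrable test_function_L2 test_function_frechet_derivative \<phi> \<psi>)+
  ultimately show "(\<integral>x. \<phi> x * frechet_derivative \<psi> (at x) b \<partial>M) = - (\<integral>x. frechet_derivative \<phi> (at x) b * \<psi> x \<partial>M)"
    by (simp add: eq_neg_iff_add_eq_0)
qed

lemma test_function_H1: "test_function D \<phi> \<Longrightarrow> \<phi> \<in> H1 D"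
  using is_weak_partial_test_function test_function_L2 by (auto simp: H1_def)

lemma is_weak_partial_unique:
  assumes "is_weak_partial D b u v" "is_weak_partial D b u v'"
  shows "AE x in M. v x = v' x"
proof -
  have v: "v \<in> L2 M" "v' \<in> L2 M" using assms by (auto simp: is_weak_partial_def)
  have "AE x in M. v x - v' x = 0"
  proof (rule fundamental_lemma_of_variations[OF open_D])
    show "integrable M (\<lambda>x. v x - v' x)"
      using v by (intro Bochner_Integration.integrable_diff L2_integrable)
    fix \<phi> assume \<phi>: "test_function D \<phi>"
    have "(\<integral>x. v x * \<phi> x \<partial>M) = (\<integral>x. v' x * \<phi> x \<partial>M)"
      using assms \<phi> by (simp add: is_weak_partial_def)
    then show "(\<integral>x. (v x - v' x) * \<phi> x \<partial>M) = 0"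
      using v test_function_L2[OF \<phi>] by (simp add: left_diff_distrib L2_mult_integrable)
  qed
  then show ?thesis by eventually_elim simp
qed

lemma is_weak_partial_cong:
  assumes w: "is_weak_partial D b u v"
    and u': "u' \<in> borel_measurable M" "AE x in M. u x = u' x"
    and v': "v' \<in> borel_measurable M" "AE x in M. v x = v' x"
  shows "is_weak_partial D b u' v'"
proof -
  have u: "u \<in> L2 M" and v: "v \<in> L2 M" using w by (auto simp: is_weak_partial_def)
  have u'L: "u' \<in> L2 M" by (rule L2_cong_AE[OF u u'])
  have v'L: "v' \<in> L2 M" by (rule L2_cong_AE[OF v v'])
  have cong: "(\<integral>x. f x * h x \<partial>M) = (\<integral>x. f' x * h x \<partial>M)"
    if "f \<in> L2 M" "f' \<in> L2 M" "test_function D h" "AE x in M. f x = f' x" for f f' h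
  proof (rule integral_cong_AE)
    show "AE x in M. f x * h x = f' x * h x" using that(4) by eventually_elim simp
  qed (intro borel_measurable_integrable L2_mult_integrable test_function_L2 that)+
  show ?thesis
    unfolding is_weak_partial_def
  proof (intro conjI allI impI u'L v'L)
    fix \<phi> assume \<phi>: "test_function D \<phi>"
    note cong[OF u u'L test_function_frechet_derivative[OF \<phi>] u'(2), of b, symmetric]
    also have "(\<integral>x. u x * frechet_derivative \<phi> (at x) b \<partial>M) = - (\<integral>x. v x * \<phi> x \<partial>M)"
      using w \<phi> by (simp add: is_weak_partial_def)
    also note cong[OF v v'L \<phi> v'(2)]
    finally show "(\<integral>x. u' x * frechet_derivative \<phi> (at x) b \<partial>M) = - (\<integral>x. v' x * \<phi> x \<partial>M)" .
  qed
qed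

lemma is_weak_partial_add:
  assumes "is_weak_partial D b u v" "is_weak_partial D b u' v'"
  shows "is_weak_partial D b (\<lambda>x. u x + u' x) (\<lambda>x. v x + v' x)"
proof -
  have L: "u \<in> L2 M" "v \<in> L2 M" "u' \<in> L2 M" "v' \<in> L2 M" using assms by (auto simp: is_weak_partial_def)
  have "(\<integral>x. (f x + g x) * h x \<partial>M) = (\<integral>x. f x * h x \<partial>M) + (\<integral>x. g x * h x \<partial>M)"
    if "f \<in> L2 M" "g \<in> L2 M" "test_function D h" for f g h
    using that by (simp add: distrib_right L2_mult_integrable test_function_L2)
  then show ?thesis
    using assms L test_function_frechet_derivative[of D]
    by (simp add: is_weak_partial_def L2_add)
qed

lemma is_weak_partial_scale:
  "is_weak_partial D b u v \<Longrightarrow> is_weak_partial D b (\<lambda>x. c * u x) (\<lambda>x. c * v x)"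
  by (simp add: is_weak_partial_def L2_scale mult.assoc)

lemma is_weak_partial_limit:
  assumes w: "\<And>n. is_weak_partial D b (f n) (g n)" and u: "u \<in> L2 M" and v: "v \<in> L2 M"
    and f: "(\<lambda>n. ip_norm (L2_inner M) (\<lambda>x. f n x - u x)) \<longlonglongrightarrow> 0"
    and g: "(\<lambda>n. ip_norm (L2_inner M) (\<lambda>x. g n x - v x)) \<longlonglongrightarrow> 0"
  shows "is_weak_partial D b u v"
  unfolding is_weak_partial_def
proof (intro conjI allI impI u v)
  have lim: "(\<lambda>n. \<integral>x. F n x * h x \<partial>M) \<longlonglongrightarrow> (\<integral>x. U x * h x \<partial>M)"
    if F: "\<And>n. F n \<in> L2 M" and U: "U \<in> L2 M" and h: "h \<in> L2 M"
      and conv: "(\<lambda>n. ip_norm (L2_inner M) (\<lambda>x. F n x - U x)) \<longlonglongrightarrow> 0" for F U h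
  proof -
    let ?h = "\<lambda>x. cnj (h x)"
    have eq: "L2_inner M (\<lambda>x. F n x - U x) ?h = (\<integral>x. F n x * h x \<partial>M) - (\<integral>x. U x * h x \<partial>M)" for n
      unfolding L2.ip_diff[OF F U L2_cnj[OF h]] by (simp add: L2_inner_def)
    have "norm ((\<integral>x. F n x * h x \<partial>M) - (\<integral>x. U x * h x \<partial>M))
        \<le> ip_norm (L2_inner M) (\<lambda>x. F n x - U x) * ip_norm (L2_inner M) ?h" for n
      using L2.Cauchy_Schwarz[OF L2.diff_in[OF F U] L2_cnj[OF h], of n] by (simp add: eq)
    moreover have "(\<lambda>n. ip_norm (L2_inner M) (\<lambda>x. F n x - U x) * ip_norm (L2_inner M) ?h) \<longlonglongrightarrow> 0"
      using tendsto_mult_right[OF conv, of "ip_norm (L2_inner M) ?h"] by simp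
    ultimately have "(\<lambda>n. (\<integral>x. F n x * h x \<partial>M) - (\<integral>x. U x * h x \<partial>M)) \<longlonglongrightarrow> 0"
      by (rule Lim_null_comparison[OF always_eventually[OF allI]])
    then show ?thesis by (simp add: LIM_zero_iff)
  qed
  have fg: "f n \<in> L2 M" "g n \<in> L2 M" for n using w by (auto simp: is_weak_partial_def)
  fix \<phi> assume \<phi>: "test_function D \<phi>"
  have "(\<lambda>n. \<integral>x. f n x * frechet_derivative \<phi> (at x) b \<partial>M) \<longlonglongrightarrow> (\<integral>x. u x * frechet_derivative \<phi> (at x) b \<partial>M)"
    by (intro lim fg u f test_function_L2 test_function_frechet_derivative \<phi>)
  moreover have "(\<lambda>n. - (\<integral>x. g n x * \<phi> x \<partial>M)) \<longlonglongrightarrow> - (\<integral>x. v x * \<phi> x \<partial>M)"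
    by (intro tendsto_minus lim fg v g test_function_L2 \<phi>)
  moreover have "(\<integral>x. f n x * frechet_derivative \<phi> (at x) b \<partial>M) = - (\<integral>x. g n x * \<phi> x \<partial>M)" for n
    using w[of n] \<phi> by (simp add: is_weak_partial_def)
  ultimately show "(\<integral>x. u x * frechet_derivative \<phi> (at x) b \<partial>M) = - (\<integral>x. v x * \<phi> x \<partial>M)"
    using LIMSEQ_unique by simp
qed

lemma weak_partial_eq: "is_weak_partial D b u v \<Longrightarrow> AE x in M. weak_partial D b u x = v x"
  unfolding weak_partial_def
  by (rule is_weak_partial_unique[OF someI[where P = "is_weak_partial D b u"]])

lemma weak_partial_add:
  "u \<in> H1 D \<Longrightarrow> v \<in> H1 D \<Longrightarrow> b \<in> Basis \<Longrightarrow>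
    AE x in M. weak_partial D b (\<lambda>x. u x + v x) x = weak_partial D b u x + weak_partial D b v x"
  by (intro weak_partial_eq is_weak_partial_add weak_partial_spec)

lemma weak_partial_scale:
  "u \<in> H1 D \<Longrightarrow> b \<in> Basis \<Longrightarrow>
    AE x in M. weak_partial D b (\<lambda>x. c * u x) x = c * weak_partial D b u x"
  by (intro weak_partial_eq is_weak_partial_scale weak_partial_spec)

lemma H1_zero: "(\<lambda>x. 0) \<in> H1 D"
  using is_weak_partial_zero L2_zero by (auto simp: H1_def)

lemma H1_add: "u \<in> H1 D \<Longrightarrow> v \<in> H1 D \<Longrightarrow> (\<lambda>x. u x + v x) \<in> H1 D"
  unfolding H1_def using is_weak_partial_add by (blast intro: L2_add)

lemma H1_scale: "u \<in> H1 D \<Longrightarrow> (\<lambda>x. c * u x) \<in> H1 D"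
  unfolding H1_def using is_weak_partial_scale by (blast intro: L2_scale)

lemma is_weak_partial_cong_H1:
  assumes u: "u \<in> H1 D" and b: "b \<in> Basis" and u': "u' \<in> borel_measurable M" "AE x in M. u x = u' x"
  shows "is_weak_partial D b u' (weak_partial D b u)"
  by (rule is_weak_partial_cong[OF weak_partial_spec[OF u b] u'])
    (simp_all add: L2_measurable weak_partial_L2 u b)

lemma H1_cong:
  assumes "u \<in> H1 D" "u' \<in> borel_measurable M" "AE x in M. u x = u' x"
  shows "u' \<in> H1 D"
  using is_weak_partial_cong_H1[OF assms(1) _ assms(2,3)] L2_cong_AE[OF H1_L2[OF assms(1)] assms(2,3)]
  by (auto simp: H1_def)

lemma weak_partial_cong:
  assumes "u \<in> H1 D" "u' \<in> borel_measurable M" "AE x in M. u x = u' x" "b \<in> Basis"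
  shows "AE x in M. weak_partial D b u' x = weak_partial D b u x"
  by (rule weak_partial_eq[OF is_weak_partial_cong_H1[OF assms(1,4,2,3)]])

lemma weak_partial_add_H1:
  assumes "u \<in> H2 D" "v \<in> H2 D" "b \<in> Basis"
  shows "weak_partial D b (\<lambda>x. u x + v x) \<in> H1 D"
proof (rule H1_cong)
  show "(\<lambda>x. weak_partial D b u x + weak_partial D b v x) \<in> H1 D"
    by (intro H1_add weak_partial_H1 assms)
  show "weak_partial D b (\<lambda>x. u x + v x) \<in> borel_measurable M"
    by (intro L2_measurable weak_partial_L2 H1_add H2_H1 assms)
  show "AE x in M. weak_partial D b u x + weak_partial D b v x = weak_partial D b (\<lambda>x. u x + v x) x"
    using weak_partial_add[OF H2_H1[OF assms(1)] H2_H1[OF assms(2)] assms(3)] by eventually_elim simp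
qed

lemma weak_partial_scale_H1:
  assumes "u \<in> H2 D" "b \<in> Basis"
  shows "weak_partial D b (\<lambda>x. c * u x) \<in> H1 D"
proof (rule H1_cong)
  show "(\<lambda>x. c * weak_partial D b u x) \<in> H1 D"
    by (intro H1_scale weak_partial_H1 assms)
  show "weak_partial D b (\<lambda>x. c * u x) \<in> borel_measurable M"
    by (intro L2_measurable weak_partial_L2 H1_scale H2_H1 assms)
  show "AE x in M. c * weak_partial D b u x = weak_partial D b (\<lambda>x. c * u x) x"
    using weak_partial_scale[OF H2_H1[OF assms(1)] assms(2), of c] by eventually_elim simp
qed

lemma H2_add: "u \<in> H2 D \<Longrightarrow> v \<in> H2 D \<Longrightarrow> (\<lambda>x. u x + v x) \<in> H2 D"
  using weak_partial_add_H1 by (simp add: H2_def H1_add)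

lemma H2_scale: "u \<in> H2 D \<Longrightarrow> (\<lambda>x. c * u x) \<in> H2 D"
  using weak_partial_scale_H1 by (simp add: H2_def H1_scale)

lemma H2_zero: "(\<lambda>x. 0) \<in> H2 D"
proof -
  have "weak_partial D b (\<lambda>x. 0) \<in> H1 D" if b: "b \<in> Basis" for b
  proof (rule H1_cong[OF H1_zero])
    show "weak_partial D b (\<lambda>x. 0) \<in> borel_measurable M"
      by (intro L2_measurable weak_partial_L2 H1_zero b)
    show "AE x in M. 0 = weak_partial D b (\<lambda>x. 0) x"
      using weak_partial_eq[OF is_weak_partial_zero, of b] by eventually_elim simp
  qed
  then show ?thesis by (simp add: H2_def H1_zero)
qed

lemma weak_partial2_add:
  assumes "u \<in> H2 D" "v \<in> H2 D" "b \<in> Basis" "c \<in> Basis"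
  shows "AE x in M. weak_partial D c (weak_partial D b (\<lambda>x. u x + v x)) x =
    weak_partial D c (weak_partial D b u) x + weak_partial D c (weak_partial D b v) x"
proof -
  let ?w = "\<lambda>x. weak_partial D b u x + weak_partial D b v x"
  have "AE x in M. weak_partial D c ?w x = weak_partial D c (weak_partial D b (\<lambda>x. u x + v x)) x"
    by (rule weak_partial_cong[OF weak_partial_add_H1[OF assms(1,2,3)] _ weak_partial_add assms(4)])
      (intro L2_measurable L2_add weak_partial_L2 H2_H1 assms)+
  moreover have "AE x in M. weak_partial D c ?w x =
      weak_partial D c (weak_partial D b u) x + weak_partial D c (weak_partial D b v) x"
    by (intro weak_partial_add weak_partial_H1 assms)
  ultimately show ?thesis by eventually_elim simp
qed

lemma weak_partial2_scale:
  assumes "u \<in> H2 D" "b \<in> Basis" "c \<in> Basis"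
  shows "AE x in M. weak_partial D c (weak_partial D b (\<lambda>x. a * u x)) x =
    a * weak_partial D c (weak_partial D b u) x"
proof -
  let ?w = "\<lambda>x. a * weak_partial D b u x"
  have "AE x in M. weak_partial D c ?w x = weak_partial D c (weak_partial D b (\<lambda>x. a * u x)) x"
    by (rule weak_partial_cong[OF weak_partial_scale_H1[OF assms(1,2)] _ weak_partial_scale assms(3)])
      (intro L2_measurable L2_scale weak_partial_L2 H2_H1 assms)+
  moreover have "AE x in M. weak_partial D c ?w x = a * weak_partial D c (weak_partial D b u) x"
    by (intro weak_partial_scale weak_partial_H1 assms)
  ultimately show ?thesis by eventually_elim simp
qed

text \<open>The list \<open>[c, b]\<close> indexes \<open>\<partial>\<^sub>c \<partial>\<^sub>b\<close>.\<close>

abbreviation deriv_along :: "'a list \<Rightarrow> ('a \<Rightarrow> complex) \<Rightarrow> 'a \<Rightarrow> complex" where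
  "deriv_along \<equiv> foldr (weak_partial D)"

definition deriv_indices1 :: "'a list set" where
  "deriv_indices1 = insert [] ((\<lambda>b. [b]) ` Basis)"

definition deriv_indices2 :: "'a list set" where
  "deriv_indices2 = deriv_indices1 \<union> (\<lambda>(b, c). [c, b]) ` (Basis \<times> Basis)"

lemma sum_deriv_indices1: "(\<Sum>xs\<in>deriv_indices1. F xs) = F [] + (\<Sum>b\<in>Basis. F [b])" for F :: "'a list \<Rightarrow> complex"
  unfolding deriv_indices1_def by (subst sum.insert) (auto simp: sum.reindex inj_on_def)

lemma sum_deriv_indices2: "(\<Sum>xs\<in>deriv_indices2. F xs) = (\<Sum>xs\<in>deriv_indices1. F xs) + (\<Sum>b\<in>Basis. \<Sum>c\<in>Basis. F [c, b])"
  for F :: "'a list \<Rightarrow> complex"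
proof -
  have "(\<Sum>xs\<in>deriv_indices2. F xs) = (\<Sum>xs\<in>deriv_indices1. F xs) + (\<Sum>xs\<in>(\<lambda>(b, c). [c, b]) ` (Basis \<times> Basis). F xs)"
    unfolding deriv_indices2_def by (intro sum.union_disjoint) (auto simp: deriv_indices1_def)
  also have "(\<Sum>xs\<in>(\<lambda>(b, c). [c, b]) ` (Basis \<times> Basis). F xs) = (\<Sum>b\<in>Basis. \<Sum>c\<in>Basis. F [c, b])"
    by (subst sum.reindex) (auto simp: inj_on_def sum.cartesian_product split_def)
  finally show ?thesis .
qed

lemma H1_family: "L2_family M (H1 D) deriv_indices1 deriv_along"
  by standard (auto simp: deriv_indices1_def H1_zero H1_add H1_scale H1_L2 weak_partial_L2
      intro: weak_partial_add weak_partial_scale)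

sublocale H1: L2_family M "H1 D" deriv_indices1 deriv_along
  by (rule H1_family)

lemma H1_inner_eq: "H1_inner D = H1.fip"
  by (intro ext) (simp add: H1_inner_def H1.fip_def sum_deriv_indices1)

lemma H1_norm_eq: "H1_norm D = ip_norm H1.fip"
  by (intro ext) (simp add: H1_norm_def ip_norm_def H1_inner_eq)

lemma X_H2: "u \<in> X_space D \<Longrightarrow> u \<in> H2 D"
  by (simp add: X_space_def)

lemma H1_0_I:
  assumes u: "u \<in> H1 D" and approx: "\<And>e. 0 < e \<Longrightarrow> \<exists>\<phi>. test_function D \<phi> \<and> ip_norm H1.fip (\<lambda>x. \<phi> x - u x) < e"
  shows "u \<in> H1_0 D"
proof -
  have "\<exists>\<phi>. test_function D \<phi> \<and> ip_norm H1.fip (\<lambda>x. \<phi> x - u x) < 1 / real (Suc n)" for n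
    by (intro approx) simp
  then obtain \<phi> where \<phi>: "\<And>n. test_function D (\<phi> n)"
    "\<And>n. ip_norm H1.fip (\<lambda>x. \<phi> n x - u x) < 1 / real (Suc n)" by metis
  have "(\<lambda>n. ip_norm H1.fip (\<lambda>x. \<phi> n x - u x)) \<longlonglongrightarrow> 0"
  proof (rule tendsto_sandwich[OF _ _ tendsto_const LIMSEQ_Suc[OF lim_1_over_n]])
    show "\<forall>\<^sub>F n in sequentially. 0 \<le> ip_norm H1.fip (\<lambda>x. \<phi> n x - u x)"
      by (intro always_eventually allI H1.nrm_nonneg H1.diff_in test_function_H1 \<phi> u)
    show "\<forall>\<^sub>F n in sequentially. ip_norm H1.fip (\<lambda>x. \<phi> n x - u x) \<le> 1 / real (Suc n)"
      by (intro always_eventually allI less_imp_le[OF \<phi>(2)])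
  qed
  then show ?thesis using u \<phi>(1) by (auto simp: H1_0_def H1_norm_eq)
qed

lemma H1_0_D:
  assumes "u \<in> H1_0 D"
  shows "u \<in> H1 D" and "0 < e \<Longrightarrow> \<exists>\<phi>. test_function D \<phi> \<and> ip_norm H1.fip (\<lambda>x. \<phi> x - u x) < e"
proof -
  obtain \<phi> where \<phi>: "\<And>m. test_function D (\<phi> m)" "(\<lambda>m. ip_norm H1.fip (\<lambda>x. \<phi> m x - u x)) \<longlonglongrightarrow> 0"
    using assms by (auto simp: H1_0_def H1_norm_eq)
  show "\<exists>\<phi>. test_function D \<phi> \<and> ip_norm H1.fip (\<lambda>x. \<phi> x - u x) < e" if "0 < e"
    using order_tendstoD(2)[OF \<phi>(2) that] \<phi>(1) unfolding eventually_sequentially by blast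
qed (use assms in \<open>simp add: H1_0_def\<close>)

lemma H1_0_zero: "(\<lambda>x. 0) \<in> H1_0 D"
  by (rule H1_0_I[OF H1_zero]) (use test_function_zero[of D] H1.nrm_zero in auto)

lemma H1_0_add:
  assumes u: "u \<in> H1_0 D" and v: "v \<in> H1_0 D"
  shows "(\<lambda>x. u x + v x) \<in> H1_0 D"
proof (rule H1_0_I)
  note uv = H1_0_D(1)[OF u] H1_0_D(1)[OF v]
  show "(\<lambda>x. u x + v x) \<in> H1 D" by (intro H1_add uv)
  fix e :: real assume "0 < e"
  then have "0 < e / 2" by simp
  from H1_0_D(2)[OF u this] H1_0_D(2)[OF v this]
  obtain \<phi> \<psi> where t: "test_function D \<phi>" "test_function D \<psi>"
    and le: "ip_norm H1.fip (\<lambda>x. \<phi> x - u x) < e / 2" "ip_norm H1.fip (\<lambda>x. \<psi> x - v x) < e / 2"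
    by blast
  have "ip_norm H1.fip (\<lambda>x. (\<phi> x - u x) + (\<psi> x - v x)) < e"
    using H1.nrm_triangle[OF H1.diff_in[OF test_function_H1[OF t(1)] uv(1)]
        H1.diff_in[OF test_function_H1[OF t(2)] uv(2)]] le by linarith
  moreover have "(\<lambda>x. (\<phi> x - u x) + (\<psi> x - v x)) = (\<lambda>x. (\<phi> x + \<psi> x) - (u x + v x))"
    by (simp add: algebra_simps)
  ultimately show "\<exists>\<phi>. test_function D \<phi> \<and> ip_norm H1.fip (\<lambda>x. \<phi> x - (u x + v x)) < e"
    using test_function_add[OF t] by (intro exI[of _ "\<lambda>x. \<phi> x + \<psi> x"]) simp
qed

lemma H1_0_scale:
  assumes u: "u \<in> H1_0 D"
  shows "(\<lambda>x. c * u x) \<in> H1_0 D"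
proof (rule H1_0_I)
  note uH = H1_0_D(1)[OF u]
  show "(\<lambda>x. c * u x) \<in> H1 D" by (intro H1_scale uH)
  fix e :: real assume e: "0 < e"
  have c: "0 < cmod c + 1" by (simp add: add_nonneg_pos)
  from e c have "0 < e / (cmod c + 1)" by simp
  from H1_0_D(2)[OF u this] obtain \<phi> where t: "test_function D \<phi>"
    and le: "ip_norm H1.fip (\<lambda>x. \<phi> x - u x) < e / (cmod c + 1)" by blast
  have d: "(\<lambda>x. \<phi> x - u x) \<in> H1 D" by (intro H1.diff_in test_function_H1 t uH)
  have "cmod c * ip_norm H1.fip (\<lambda>x. \<phi> x - u x) \<le> (cmod c + 1) * ip_norm H1.fip (\<lambda>x. \<phi> x - u x)"
    by (intro mult_right_mono H1.nrm_nonneg d) simp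
  also have "\<dots> < e" using le c by (simp add: field_simps)
  finally have "ip_norm H1.fip (\<lambda>x. c * (\<phi> x - u x)) < e" unfolding H1.nrm_scale[OF d] .
  then show "\<exists>\<phi>. test_function D \<phi> \<and> ip_norm H1.fip (\<lambda>x. \<phi> x - c * u x) < e"
    using test_function_scale[OF t, of c] by (intro exI[of _ "\<lambda>x. c * \<phi> x"]) (simp add: right_diff_distrib)
qed

lemma H1_0_closed:
  assumes f: "\<And>n. f n \<in> H1_0 D" and u: "u \<in> H1 D"
    and lim: "(\<lambda>n. ip_norm H1.fip (\<lambda>x. f n x - u x)) \<longlonglongrightarrow> 0"
  shows "u \<in> H1_0 D"
proof (rule H1_0_I[OF u])
  fix e :: real assume "0 < e"
  then have e: "0 < e / 2" by simp
  obtain n where n: "ip_norm H1.fip (\<lambda>x. f n x - u x) < e / 2"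
    using order_tendstoD(2)[OF lim e] unfolding eventually_sequentially by blast
  obtain \<phi> where \<phi>: "test_function D \<phi>" "ip_norm H1.fip (\<lambda>x. \<phi> x - f n x) < e / 2"
    using H1_0_D(2)[OF f e] by blast
  have "ip_norm H1.fip (\<lambda>x. \<phi> x - u x) < e"
    using H1.nrm_diff_triangle[OF test_function_H1[OF \<phi>(1)] H1_0_D(1)[OF f] u, of n] n \<phi>(2) by linarith
  then show "\<exists>\<phi>. test_function D \<phi> \<and> ip_norm H1.fip (\<lambda>x. \<phi> x - u x) < e" using \<phi>(1) by blast
qed

lemma X_family: "L2_family M (X_space D) deriv_indices2 deriv_along"
  by standard (auto simp: deriv_indices1_def deriv_indices2_def X_space_def H2_zero H2_add H2_scale H1_0_zero H1_0_add H1_0_scale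
      H1_L2 H2_H1 weak_partial_L2 weak_partial_H1
      intro: weak_partial_add[OF H2_H1 H2_H1] weak_partial_scale[OF H2_H1] weak_partial2_add weak_partial2_scale)

sublocale X: L2_family M "X_space D" deriv_indices2 deriv_along
  by (rule X_family)

lemma H2_inner_eq: "H2_inner D = X.fip"
  by (intro ext) (simp add: H2_inner_def H1_inner_def X.fip_def sum_deriv_indices1 sum_deriv_indices2)

lemma H2_norm_eq: "H2_norm D = ip_norm X.fip"
  by (intro ext) (simp add: H2_norm_def ip_norm_def H2_inner_eq)

lemma X_complete: "ip_complete (X_space D) X.fip"
proof (rule X.complete_if_closed)
  fix f g
  assume f: "\<And>n. f n \<in> X_space D" and g: "\<And>i. i \<in> deriv_indices2 \<Longrightarrow> g i \<in> L2 M"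
    and lim: "\<And>i. i \<in> deriv_indices2 \<Longrightarrow> (\<lambda>n. ip_norm (L2_inner M) (\<lambda>x. deriv_along i (f n) x - g i x)) \<longlonglongrightarrow> 0"
  define u where "u = g []"
  have fH: "f n \<in> H2 D" for n using f X_H2 by blast
  have in2: "[] \<in> deriv_indices2" "b \<in> Basis \<Longrightarrow> [b] \<in> deriv_indices2" "b \<in> Basis \<Longrightarrow> c \<in> Basis \<Longrightarrow> [c, b] \<in> deriv_indices2" for b c :: 'a
    by (auto simp: deriv_indices1_def deriv_indices2_def)
  have w1: "is_weak_partial D b u (g [b])" if b: "b \<in> Basis" for b
    by (rule is_weak_partial_limit[OF weak_partial_spec[OF H2_H1[OF fH] b]])
      (use lim[OF in2(1)] lim[OF in2(2)[OF b]] g in2 b in \<open>auto simp: u_def\<close>)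
  have w2: "is_weak_partial D c (g [b]) (g [c, b])" if b: "b \<in> Basis" and c: "c \<in> Basis" for b c
    by (rule is_weak_partial_limit[OF weak_partial_spec[OF weak_partial_H1[OF fH b] c]])
      (use lim[OF in2(2)[OF b]] lim[OF in2(3)[OF b c]] g in2 b c in auto)
  have uH1: "u \<in> H1 D" using w1 g[OF in2(1)] by (auto simp: H1_def u_def)
  have gH1: "g [b] \<in> H1 D" if "b \<in> Basis" for b
    using w2 that g[OF in2(2)] by (auto simp: H1_def)
  have eq1: "AE x in M. weak_partial D b u x = g [b] x" if "b \<in> Basis" for b
    by (rule weak_partial_eq[OF w1[OF that]])
  have eq1': "AE x in M. g [b] x = weak_partial D b u x" if "b \<in> Basis" for b
    using eq1[OF that] by eventually_elim simp
  have wm: "weak_partial D b u \<in> borel_measurable M" if "b \<in> Basis" for b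
    by (intro L2_measurable weak_partial_L2 uH1 that)
  have uH2: "u \<in> H2 D"
    using uH1 H1_cong[OF gH1 wm eq1'] by (simp add: H2_def)
  have eq2: "AE x in M. weak_partial D c (weak_partial D b u) x = g [c, b] x" if "b \<in> Basis" "c \<in> Basis" for b c
    using weak_partial_cong[OF gH1[OF that(1)] wm[OF that(1)] eq1'[OF that(1)] that(2)]
      weak_partial_eq[OF w2[OF that]]
    by eventually_elim simp
  have all: "AE x in M. deriv_along i u x = g i x" if "i \<in> deriv_indices2" for i
    using that eq1 eq2 by (auto simp: deriv_indices1_def deriv_indices2_def u_def)
  have "u \<in> H1_0 D"
  proof (rule H1_0_closed[OF _ uH1])
    show "f n \<in> H1_0 D" for n using f by (simp add: X_space_def)
    show "(\<lambda>n. ip_norm H1.fip (\<lambda>x. f n x - u x)) \<longlonglongrightarrow> 0"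
    proof (rule H1.tendsto_if_components[OF H2_H1[OF fH] uH1])
      fix i assume i: "i \<in> deriv_indices1"
      then have i2: "i \<in> deriv_indices2" by (simp add: deriv_indices2_def)
      have "ip_norm (L2_inner M) (\<lambda>x. deriv_along i (f n) x - deriv_along i u x)
          = ip_norm (L2_inner M) (\<lambda>x. deriv_along i (f n) x - g i x)" for n
      proof (rule L2_norm_cong_AE)
        show "AE x in M. deriv_along i (f n) x - deriv_along i u x = deriv_along i (f n) x - g i x"
          using all[OF i2] by eventually_elim simp
      qed (intro L2.diff_in H1.T_L2 g i i2 H2_H1 fH uH2)+
      then show "(\<lambda>n. ip_norm (L2_inner M) (\<lambda>x. deriv_along i (f n) x - deriv_along i u x)) \<longlonglongrightarrow> 0"
        using lim[OF i2] by simp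
    qed
  qed
  then show "\<exists>u\<in>X_space D. \<forall>i\<in>deriv_indices2. AE x in M. deriv_along i u x = g i x"
    using uH2 all by (auto simp: X_space_def)
qed

section \<open>The volume terms of the form\<close>

lemma second_in_deriv_indices2: "b \<in> Basis \<Longrightarrow> [b, b] \<in> deriv_indices2"
  by (auto simp: deriv_indices2_def)

lemma laplacian_eq: "laplacian D u = (\<lambda>x. \<Sum>b\<in>Basis. deriv_along [b, b] u x)"
  by (simp add: laplacian_def fun_eq_iff)

lemma laplacian_L2: "u \<in> X_space D \<Longrightarrow> laplacian D u \<in> L2 M"
  unfolding laplacian_eq by (intro L2.sum_in finite_Basis X.T_L2 second_in_deriv_indices2)

lemma laplacian_norm_le:
  assumes u: "u \<in> X_space D"
  shows "ip_norm (L2_inner M) (laplacian D u) \<le> DIM('a) * ip_norm X.fip u"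
proof -
  have "ip_norm (L2_inner M) (laplacian D u) \<le> (\<Sum>b\<in>Basis. ip_norm (L2_inner M) (deriv_along [b, b] u))"
    unfolding laplacian_eq by (intro L2.nrm_sum_le finite_Basis X.T_L2 second_in_deriv_indices2 u)
  also have "\<dots> \<le> (\<Sum>b\<in>(Basis::'a set). ip_norm X.fip u)"
    by (intro sum_mono X.component_le second_in_deriv_indices2 u)
  finally show ?thesis by simp
qed

lemma laplacian_add:
  assumes "u \<in> X_space D" "v \<in> X_space D"
  shows "AE x in M. laplacian D (\<lambda>x. u x + v x) x = laplacian D u x + laplacian D v x"
proof -
  have "AE x in M. \<forall>b\<in>Basis. deriv_along [b, b] (\<lambda>x. u x + v x) x = deriv_along [b, b] u x + deriv_along [b, b] v x"
    by (intro AE_finite_allI finite_Basis X.T_add second_in_deriv_indices2 assms)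
  then show ?thesis
    unfolding laplacian_eq by eventually_elim (simp add: sum.distrib del: foldr.simps)
qed

lemma laplacian_scale:
  assumes "u \<in> X_space D"
  shows "AE x in M. laplacian D (\<lambda>x. c * u x) x = c * laplacian D u x"
proof -
  have "AE x in M. \<forall>b\<in>Basis. deriv_along [b, b] (\<lambda>x. c * u x) x = c * deriv_along [b, b] u x"
    by (intro AE_finite_allI finite_Basis X.T_scale second_in_deriv_indices2 assms)
  then show ?thesis
    unfolding laplacian_eq by eventually_elim (simp add: sum_distrib_left del: foldr.simps)
qed

lemma X_L2: "u \<in> X_space D \<Longrightarrow> u \<in> L2 M"
  by (intro H1_L2 H2_H1 X_H2)

lemma X_L2_norm_le: "u \<in> X_space D \<Longrightarrow> ip_norm (L2_inner M) u \<le> ip_norm X.fip u"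
  using X.component_le[of "[]" u] by (simp add: deriv_indices1_def deriv_indices2_def)

definition volume_form :: "complex \<Rightarrow> ('a \<Rightarrow> complex) \<Rightarrow> ('a \<Rightarrow> complex) \<Rightarrow> ('a \<Rightarrow> complex) \<Rightarrow> complex" where
  "volume_form k \<beta> u \<phi> = k ^ 3 * L2_inner M (\<lambda>x. \<beta> x * u x) \<phi>
     + k * (L2_inner M (\<lambda>x. \<beta> x * laplacian D u x) \<phi> + L2_inner M (\<lambda>x. \<beta> x * u x) (laplacian D \<phi>))"

lemma L2_inner_laplacian_add:
  assumes "f \<in> L2 M" "\<phi> \<in> X_space D" "\<psi> \<in> X_space D"
  shows "L2_inner M f (laplacian D (\<lambda>x. \<phi> x + \<psi> x)) = L2_inner M f (laplacian D \<phi>) + L2_inner M f (laplacian D \<psi>)"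
proof -
  have "L2_inner M f (laplacian D (\<lambda>x. \<phi> x + \<psi> x)) = L2_inner M f (\<lambda>x. laplacian D \<phi> x + laplacian D \<psi> x)"
    by (intro L2_inner_cong_AE laplacian_add laplacian_L2 L2_add X.V_add assms) simp
  then show ?thesis by (simp add: L2.ip_add_right laplacian_L2 assms)
qed

lemma L2_inner_laplacian_scale:
  assumes "f \<in> L2 M" "\<phi> \<in> X_space D"
  shows "L2_inner M f (laplacian D (\<lambda>x. c * \<phi> x)) = cnj c * L2_inner M f (laplacian D \<phi>)"
proof -
  have "L2_inner M f (laplacian D (\<lambda>x. c * \<phi> x)) = L2_inner M f (\<lambda>x. c * laplacian D \<phi> x)"
    by (intro L2_inner_cong_AE laplacian_scale laplacian_L2 L2_scale X.V_scale assms) simp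
  then show ?thesis by (simp add: L2.ip_scale_right laplacian_L2 assms)
qed

lemma volume_form_add:
  assumes "\<beta> \<in> borel_measurable M" "AE x in M. norm (\<beta> x) \<le> C"
    and "u \<in> X_space D" "\<phi> \<in> X_space D" "\<psi> \<in> X_space D"
  shows "volume_form k \<beta> u (\<lambda>x. \<phi> x + \<psi> x) = volume_form k \<beta> u \<phi> + volume_form k \<beta> u \<psi>"
  using L2_bounded_mult[OF assms(1,2) X_L2[OF assms(3)]] L2_bounded_mult[OF assms(1,2) laplacian_L2[OF assms(3)]]
  by (simp add: volume_form_def L2.ip_add_right X_L2 L2_inner_laplacian_add assms algebra_simps)

lemma volume_form_scale:
  assumes "\<beta> \<in> borel_measurable M" "AE x in M. norm (\<beta> x) \<le> C"
    and "u \<in> X_space D" "\<phi> \<in> X_space D"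
  shows "volume_form k \<beta> u (\<lambda>x. c * \<phi> x) = cnj c * volume_form k \<beta> u \<phi>"
  using L2_bounded_mult[OF assms(1,2) X_L2[OF assms(3)]] L2_bounded_mult[OF assms(1,2) laplacian_L2[OF assms(3)]]
  by (simp add: volume_form_def L2.ip_scale_right X_L2 L2_inner_laplacian_scale assms algebra_simps)

lemma volume_form_bound:
  assumes \<beta>: "\<beta> \<in> borel_measurable M" "AE x in M. norm (\<beta> x) \<le> C" and C: "0 \<le> C"
    and u: "u \<in> X_space D" and \<phi>: "\<phi> \<in> X_space D"
  shows "cmod (volume_form k \<beta> u \<phi>) \<le> C * (cmod k ^ 3 + 2 * cmod k * DIM('a)) * ip_norm X.fip u * ip_norm X.fip \<phi>"
proof -
  define U where "U = ip_norm X.fip u"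
  define P where "P = ip_norm X.fip \<phi>"
  let ?d = "real DIM('a)"
  have U0: "0 \<le> U" and P0: "0 \<le> P" unfolding U_def P_def by (intro X.nrm_nonneg u \<phi>)+
  have \<beta>u: "(\<lambda>x. \<beta> x * u x) \<in> L2 M" by (intro L2_bounded_mult[OF \<beta>] X_L2 u)
  have \<beta>Lu: "(\<lambda>x. \<beta> x * laplacian D u x) \<in> L2 M" by (intro L2_bounded_mult[OF \<beta>] laplacian_L2 u)
  have n1: "ip_norm (L2_inner M) (\<lambda>x. \<beta> x * u x) \<le> C * U"
    using L2_norm_bounded_mult[OF \<beta> X_L2[OF u] C] mult_left_mono[OF X_L2_norm_le[OF u] C] by (simp add: U_def)
  have n2: "ip_norm (L2_inner M) (\<lambda>x. \<beta> x * laplacian D u x) \<le> C * (?d * U)"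
    using L2_norm_bounded_mult[OF \<beta> laplacian_L2[OF u] C] mult_left_mono[OF laplacian_norm_le[OF u] C] by (simp add: U_def)
  have n3: "ip_norm (L2_inner M) \<phi> \<le> P" using X_L2_norm_le[OF \<phi>] by (simp add: P_def)
  have n4: "ip_norm (L2_inner M) (laplacian D \<phi>) \<le> ?d * P" using laplacian_norm_le[OF \<phi>] by (simp add: P_def)
  have CS: "cmod (L2_inner M f g) \<le> a * b"
    if "f \<in> L2 M" "g \<in> L2 M" "ip_norm (L2_inner M) f \<le> a" "ip_norm (L2_inner M) g \<le> b" for f g a b
  proof -
    have "ip_norm (L2_inner M) f * ip_norm (L2_inner M) g \<le> a * b"
      using that L2.nrm_nonneg[OF that(1)] L2.nrm_nonneg[OF that(2)] by (intro mult_mono) linarith+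
    then show ?thesis using L2.Cauchy_Schwarz[OF that(1,2)] by linarith
  qed
  have t1: "cmod (L2_inner M (\<lambda>x. \<beta> x * u x) \<phi>) \<le> C * U * P"
    by (intro CS \<beta>u X_L2 \<phi> n1 n3)
  have t2: "cmod (L2_inner M (\<lambda>x. \<beta> x * laplacian D u x) \<phi>) \<le> C * (?d * U) * P"
    by (intro CS \<beta>Lu X_L2 \<phi> n2 n3)
  have t3: "cmod (L2_inner M (\<lambda>x. \<beta> x * u x) (laplacian D \<phi>)) \<le> C * U * (?d * P)"
    by (intro CS \<beta>u laplacian_L2 \<phi> n1 n4)
  have "cmod (volume_form k \<beta> u \<phi>) \<le> cmod k ^ 3 * cmod (L2_inner M (\<lambda>x. \<beta> x * u x) \<phi>)
      + cmod k * (cmod (L2_inner M (\<lambda>x. \<beta> x * laplacian D u x) \<phi>) + cmod (L2_inner M (\<lambda>x. \<beta> x * u x) (laplacian D \<phi>)))"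
    unfolding volume_form_def
    by (rule order_trans[OF norm_triangle_ineq])
      (auto simp: norm_mult norm_power intro!: add_left_mono mult_left_mono norm_triangle_ineq)
  also have "\<dots> \<le> cmod k ^ 3 * (C * U * P) + cmod k * (C * (?d * U) * P + C * U * (?d * P))"
    by (intro add_mono mult_left_mono t1 t2 t3) simp_all
  also have "\<dots> = C * (cmod k ^ 3 + 2 * cmod k * ?d) * U * P" by (simp add: algebra_simps)
  finally show ?thesis by (simp add: U_def P_def)
qed

lemma volume_form_diff:
  assumes "\<beta> \<in> borel_measurable M" "AE x in M. norm (\<beta> x) \<le> C"
    and "\<gamma> \<in> borel_measurable M" "AE x in M. norm (\<gamma> x) \<le> C'"
    and u: "u \<in> X_space D" and \<phi>: "\<phi> \<in> X_space D"
  shows "volume_form k (\<lambda>x. \<beta> x - \<gamma> x) u \<phi> = volume_form k \<beta> u \<phi> - volume_form k \<gamma> u \<phi>"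
proof -
  note m = L2_bounded_mult[OF assms(1,2)] L2_bounded_mult[OF assms(3,4)]
  show ?thesis
    unfolding volume_form_def left_diff_distrib
    by (simp add: L2.ip_diff m X_L2 laplacian_L2 u \<phi> right_diff_distrib algebra_simps)
qed

lemma B_form_eq:
  assumes n: "n1 \<in> borel_measurable M" "n2 \<in> borel_measurable M"
    and c: "0 < c" "AE x in M. c \<le> \<bar>n1 x - 1\<bar>" and k: "0 < Re k"
    and u: "u \<in> X_space D" and \<phi>: "\<phi> \<in> X_space D"
  defines "\<beta> \<equiv> \<lambda>x. 1 / (k * complex_of_real (n1 x - 1) + \<i> * complex_of_real (n2 x))"
  shows "\<beta> \<in> borel_measurable M" "AE x in M. norm (\<beta> x) \<le> 1 / (Re k * c)"
    "B_form D \<eta> n1 n2 k u \<phi> =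
       (\<integral>x. complex_of_real (1 / \<eta> x) * normal_derivative D u x * cnj (normal_derivative D \<phi> x) \<partial>surface_measure D)
     - (\<integral>x. (\<Sum>b\<in>Basis. weak_partial D b u x * cnj (weak_partial D b \<phi> x)) \<partial>M)
     + k\<^sup>2 * L2_inner M u \<phi> + volume_form k \<beta> u \<phi>"
proof -
  define d where "d x = k * complex_of_real (n1 x - 1) + \<i> * complex_of_real (n2 x)" for x
  have \<beta>d: "\<beta> x = 1 / d x" for x by (simp add: \<beta>_def d_def)
  show \<beta>m: "\<beta> \<in> borel_measurable M" unfolding \<beta>_def using n by measurable
  have kc: "0 < Re k * c" using k c(1) by simp
  have dge: "AE x in M. Re k * c \<le> cmod (d x)"
    using c(2)
  proof eventually_elim
    fix x assume "c \<le> \<bar>n1 x - 1\<bar>"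
    then have "Re k * c \<le> \<bar>Re (d x)\<bar>" using k by (simp add: d_def abs_mult)
    then show "Re k * c \<le> cmod (d x)" using abs_Re_le_cmod[of "d x"] by linarith
  qed
  then show \<beta>b: "AE x in M. norm (\<beta> x) \<le> 1 / (Re k * c)"
  proof eventually_elim
    fix x assume "Re k * c \<le> cmod (d x)"
    then show "norm (\<beta> x) \<le> 1 / (Re k * c)" using kc by (simp add: \<beta>d norm_divide frac_le)
  qed
  have \<beta>u: "(\<lambda>x. \<beta> x * u x) \<in> L2 M" by (intro L2_bounded_mult[OF \<beta>m \<beta>b] X_L2 u)
  have \<beta>Lu: "(\<lambda>x. \<beta> x * laplacian D u x) \<in> L2 M" by (intro L2_bounded_mult[OF \<beta>m \<beta>b] laplacian_L2 u)
  have i1: "integrable M (\<lambda>x. u x * cnj (\<phi> x))" by (intro L2_mult_integrable L2_cnj X_L2 u \<phi>)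
  have i2: "integrable M (\<lambda>x. \<beta> x * u x * cnj (\<phi> x))" by (intro L2_mult_integrable L2_cnj X_L2 \<beta>u \<phi>)
  have i3: "integrable M (\<lambda>x. \<beta> x * laplacian D u x * cnj (\<phi> x))" by (intro L2_mult_integrable L2_cnj X_L2 \<beta>Lu \<phi>)
  have i4: "integrable M (\<lambda>x. \<beta> x * u x * cnj (laplacian D \<phi> x))"
    by (intro L2_mult_integrable L2_cnj laplacian_L2 \<beta>u \<phi>)
  have "(\<integral>x. (k * complex_of_real (n1 x) + \<i> * complex_of_real (n2 x)) /
           (k * complex_of_real (n1 x - 1) + \<i> * complex_of_real (n2 x)) * u x * cnj (\<phi> x) \<partial>M)
      = (\<integral>x. u x * cnj (\<phi> x) + k * (\<beta> x * u x * cnj (\<phi> x)) \<partial>M)"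
  proof (rule integral_cong_AE)
    have [measurable]: "u \<in> borel_measurable M" "(\<lambda>x. cnj (\<phi> x)) \<in> borel_measurable M"
      by (intro L2_measurable L2_cnj X_L2 u \<phi>)+
    note [measurable] = n
    show "(\<lambda>x. (k * complex_of_real (n1 x) + \<i> * complex_of_real (n2 x)) /
           (k * complex_of_real (n1 x - 1) + \<i> * complex_of_real (n2 x)) * u x * cnj (\<phi> x)) \<in> borel_measurable M"
      by measurable
    show "(\<lambda>x. u x * cnj (\<phi> x) + k * (\<beta> x * u x * cnj (\<phi> x))) \<in> borel_measurable M"
      by (intro borel_measurable_integrable Bochner_Integration.integrable_add integrable_mult_right i1 i2)
    show "AE x in M. (k * complex_of_real (n1 x) + \<i> * complex_of_real (n2 x)) /
           (k * complex_of_real (n1 x - 1) + \<i> * complex_of_real (n2 x)) * u x * cnj (\<phi> x)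
        = u x * cnj (\<phi> x) + k * (\<beta> x * u x * cnj (\<phi> x))"
      using dge
    proof eventually_elim
      fix x assume "Re k * c \<le> cmod (d x)"
      then have "d x \<noteq> 0" using kc by auto
      moreover have "k * complex_of_real (n1 x) + \<i> * complex_of_real (n2 x) = d x + k"
        by (simp add: d_def algebra_simps)
      ultimately have "(k * complex_of_real (n1 x) + \<i> * complex_of_real (n2 x)) / d x = 1 + k * \<beta> x"
        by (simp add: \<beta>d add_divide_distrib)
      then show "(k * complex_of_real (n1 x) + \<i> * complex_of_real (n2 x)) /
           (k * complex_of_real (n1 x - 1) + \<i> * complex_of_real (n2 x)) * u x * cnj (\<phi> x)
        = u x * cnj (\<phi> x) + k * (\<beta> x * u x * cnj (\<phi> x))"
        unfolding d_def[symmetric] by (simp add: algebra_simps)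
    qed
  qed
  also have "\<dots> = L2_inner M u \<phi> + k * L2_inner M (\<lambda>x. \<beta> x * u x) \<phi>"
    using i1 i2 by (simp add: L2_inner_def)
  finally have e1: "(\<integral>x. (k * complex_of_real (n1 x) + \<i> * complex_of_real (n2 x)) /
           (k * complex_of_real (n1 x - 1) + \<i> * complex_of_real (n2 x)) * u x * cnj (\<phi> x) \<partial>M)
      = L2_inner M u \<phi> + k * L2_inner M (\<lambda>x. \<beta> x * u x) \<phi>" .
  have "(\<integral>x. \<beta> x * (cnj (\<phi> x) * laplacian D u x + u x * cnj (laplacian D \<phi> x)) \<partial>M)
      = (\<integral>x. \<beta> x * laplacian D u x * cnj (\<phi> x) + \<beta> x * u x * cnj (laplacian D \<phi> x) \<partial>M)"
    by (intro Bochner_Integration.integral_cong refl) (simp add: algebra_simps)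
  also have "\<dots> = L2_inner M (\<lambda>x. \<beta> x * laplacian D u x) \<phi> + L2_inner M (\<lambda>x. \<beta> x * u x) (laplacian D \<phi>)"
    using i3 i4 by (simp add: L2_inner_def)
  finally have e2: "(\<integral>x. 1 / (k * complex_of_real (n1 x - 1) + \<i> * complex_of_real (n2 x)) *
        (cnj (\<phi> x) * laplacian D u x + u x * cnj (laplacian D \<phi> x)) \<partial>M)
      = L2_inner M (\<lambda>x. \<beta> x * laplacian D u x) \<phi> + L2_inner M (\<lambda>x. \<beta> x * u x) (laplacian D \<phi>)"
    by (simp only: \<beta>_def)
  show "B_form D \<eta> n1 n2 k u \<phi> =
       (\<integral>x. complex_of_real (1 / \<eta> x) * normal_derivative D u x * cnj (normal_derivative D \<phi> x) \<partial>surface_measure D)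
     - (\<integral>x. (\<Sum>b\<in>Basis. weak_partial D b u x * cnj (weak_partial D b \<phi> x)) \<partial>M)
     + k\<^sup>2 * L2_inner M u \<phi> + volume_form k \<beta> u \<phi>"
    unfolding B_form_def e1 e2 volume_form_def by (simp add: algebra_simps power2_eq_square power3_eq_cube)
qed

lemma B_op_diff_norm_le:
  assumes n1: "n1 \<in> borel_measurable M"
    and n2: "n2 \<in> borel_measurable M" "AE x in M. \<bar>n2 x\<bar> \<le> \<delta>" and \<delta>: "0 \<le> \<delta>"
    and c: "0 < c" "AE x in M. c \<le> \<bar>n1 x - 1\<bar>" and k: "0 < Re k" and u: "u \<in> X_space D"
  shows "H2_norm D (\<lambda>x. B_op D \<eta> n1 n2 k u x - B_op D \<eta> n1 (\<lambda>_. 0) k u x)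
    \<le> \<delta> / (Re k * c)\<^sup>2 * (cmod k ^ 3 + 2 * cmod k * DIM('a)) * H2_norm D u"
proof -
  define d where "d n x = k * complex_of_real (n1 x - 1) + \<i> * complex_of_real (n x)" for n :: "'a \<Rightarrow> real" and x
  define \<beta> where "\<beta> n x = 1 / d n x" for n x
  define \<gamma> where "\<gamma> x = \<beta> n2 x - \<beta> (\<lambda>_. 0) x" for x
  have m0: "(\<lambda>_. 0::real) \<in> borel_measurable M" by simp
  have \<beta>m: "\<beta> n \<in> borel_measurable M" and \<beta>b: "AE x in M. norm (\<beta> n x) \<le> 1 / (Re k * c)"
    if "n \<in> borel_measurable M" for n
    using B_form_eq(1,2)[OF n1 that c k u u] by (simp_all add: \<beta>_def[abs_def] d_def)
  have \<gamma>m: "\<gamma> \<in> borel_measurable M"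
    unfolding \<gamma>_def[abs_def] by (intro borel_measurable_diff \<beta>m n2 m0)
  have kc: "0 < Re k * c" using k c(1) by simp
  let ?C = "\<delta> / (Re k * c)\<^sup>2"
  have \<gamma>b: "AE x in M. norm (\<gamma> x) \<le> ?C"
    using n2(2) c(2)
  proof eventually_elim
    fix x assume n2x: "\<bar>n2 x\<bar> \<le> \<delta>" and cx: "c \<le> \<bar>n1 x - 1\<bar>"
    have dge: "Re k * c \<le> cmod (d n x)" for n
    proof -
      have "Re k * c \<le> \<bar>Re (d n x)\<bar>" using k cx by (simp add: d_def abs_mult)
      then show ?thesis using abs_Re_le_cmod[of "d n x"] by linarith
    qed
    then have nz: "d n x \<noteq> 0" for n using kc by (metis less_le_not_le norm_zero)
    have "\<gamma> x = - (\<i> * complex_of_real (n2 x)) / (d n2 x * d (\<lambda>_. 0) x)"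
      unfolding \<gamma>_def \<beta>_def using nz by (simp add: diff_frac_eq) (simp add: d_def)
    then have "norm (\<gamma> x) = \<bar>n2 x\<bar> / (cmod (d n2 x) * cmod (d (\<lambda>_. 0) x))"
      by (simp add: norm_divide norm_mult)
    also have "\<dots> \<le> \<delta> / ((Re k * c) * (Re k * c))"
      by (intro frac_le \<delta> n2x mult_pos_pos[OF kc kc] mult_mono dge) (rule norm_ge_zero less_imp_le[OF kc])+
    finally show "norm (\<gamma> x) \<le> ?C" by (simp add: power2_eq_square)
  qed
  have C: "0 \<le> ?C" using \<delta> by simp
  have "ip_norm X.fip (\<lambda>x. (SOME w. w \<in> X_space D \<and> (\<forall>\<phi>\<in>X_space D. X.fip w \<phi> = B_form D \<eta> n1 n2 k u \<phi>)) x
      - (SOME w. w \<in> X_space D \<and> (\<forall>\<phi>\<in>X_space D. X.fip w \<phi> = B_form D \<eta> n1 (\<lambda>_. 0) k u \<phi>)) x)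
    \<le> ?C * (cmod k ^ 3 + 2 * cmod k * DIM('a)) * ip_norm X.fip u"
  proof (rule X.nrm_Eps_representer_diff[where G = "volume_form k \<gamma> u", OF X_complete])
    show "0 \<le> ?C * (cmod k ^ 3 + 2 * cmod k * DIM('a)) * ip_norm X.fip u"
      using C X.nrm_nonneg[OF u] by (intro mult_nonneg_nonneg) simp_all
    show "B_form D \<eta> n1 n2 k u \<phi> = B_form D \<eta> n1 (\<lambda>_. 0) k u \<phi> + volume_form k \<gamma> u \<phi>" if \<phi>: "\<phi> \<in> X_space D" for \<phi>
      using volume_form_diff[OF \<beta>m[OF n2(1)] \<beta>b[OF n2(1)] \<beta>m[OF m0] \<beta>b[OF m0] u \<phi>, of k]
      unfolding B_form_eq(3)[OF n1 n2(1) c k u \<phi>] B_form_eq(3)[OF n1 m0 c k u \<phi>]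
        \<gamma>_def[abs_def] \<beta>_def[abs_def] d_def by simp
  qed (rule volume_form_add[OF \<gamma>m \<gamma>b u] volume_form_scale[OF \<gamma>m \<gamma>b u] volume_form_bound[OF \<gamma>m \<gamma>b C u]; assumption)+
  then show ?thesis by (simp only: B_op_def H2_norm_eq H2_inner_eq)
qed

end

theorem theorem3p6:
  fixes D :: "(real ^ 'n) set"
    and n1 \<eta> :: "real ^ 'n \<Rightarrow> real"
    and k :: complex
  assumes "CARD('n) \<in> {2, 3}"
    and "bounded D" and "open D" and "simply_connected D" and "C2_boundary D"
    and "n1 \<in> Linf (lebesgue_on D)" and "AE x in lebesgue_on D. n1 x > 0"
    and "\<eta> \<in> Linf (surface_measure D)" and "AE x in surface_measure D. \<eta> x > 0"
    and "(\<lambda>x. 1 / \<eta> x) \<in> Linf (surface_measure D)"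
    and "\<exists>c>0. (AE x in lebesgue_on D. n1 x - 1 \<ge> c) \<or> (AE x in lebesgue_on D. n1 x - 1 \<le> - c)"
    and "Re k > 0"
  shows "\<forall>\<epsilon>>0. \<exists>\<delta>>0. \<forall>n2 \<in> Linf (lebesgue_on D).
           (AE x in lebesgue_on D. n2 x \<ge> 0) \<and> Linf_norm (lebesgue_on D) n2 < ereal \<delta> \<longrightarrow>
           X_op_norm D (\<lambda>u x. B_op D \<eta> n1 n2 k u x - B_op D \<eta> n1 (\<lambda>_. 0) k u x) < ereal \<epsilon>"
proof (intro allI impI)
  interpret bounded_domain D by standard (rule assms(2,3))+
  fix \<epsilon> :: real assume \<epsilon>: "0 < \<epsilon>"
  obtain c where c: "0 < c" "(AE x in M. n1 x - 1 \<ge> c) \<or> (AE x in M. n1 x - 1 \<le> - c)"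
    using assms(11) by blast
  from c(2) have c': "AE x in M. c \<le> \<bar>n1 x - 1\<bar>"
    by (elim disjE) (auto elim!: eventually_mono)
  have kc: "0 < Re k * c" using assms(12) c(1) by simp
  define A where "A = cmod k ^ 3 + 2 * cmod k * DIM(real ^ 'n)"
  have A: "0 \<le> A" unfolding A_def by simp
  define \<delta> where "\<delta> = \<epsilon> / 2 * (Re k * c)\<^sup>2 / (A + 1)"
  have \<delta>: "0 < \<delta>" unfolding \<delta>_def using \<epsilon> A by (intro divide_pos_pos mult_pos_pos zero_less_power kc) simp_all
  have small: "\<delta> / (Re k * c)\<^sup>2 * A \<le> \<epsilon> / 2"
  proof -
    have "\<epsilon> / 2 * q\<^sup>2 / (A + 1) / q\<^sup>2 * A = \<epsilon> / 2 * (A / (A + 1))" if "0 < q" for q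
      using that by simp
    from this[OF kc] have "\<delta> / (Re k * c)\<^sup>2 * A = \<epsilon> / 2 * (A / (A + 1))"
      unfolding \<delta>_def .
    also have "\<dots> \<le> \<epsilon> / 2 * 1" using \<epsilon> A by (intro mult_left_mono) (simp_all add: divide_le_eq)
    finally show ?thesis by simp
  qed
  show "\<exists>\<delta>>0. \<forall>n2 \<in> Linf M. (AE x in M. n2 x \<ge> 0) \<and> Linf_norm M n2 < ereal \<delta> \<longrightarrow>
      X_op_norm D (\<lambda>u x. B_op D \<eta> n1 n2 k u x - B_op D \<eta> n1 (\<lambda>_. 0) k u x) < ereal \<epsilon>"
  proof (intro exI conjI ballI impI)
    fix n2 assume n2: "n2 \<in> Linf M" and "(AE x in M. n2 x \<ge> 0) \<and> Linf_norm M n2 < ereal \<delta>"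
    then have lt: "Linf_norm M n2 < ereal \<delta>" by blast
    have "AE x in M. ereal \<bar>n2 x\<bar> \<le> Linf_norm M n2"
      unfolding Linf_norm_def by (rule esssup_AE)
    then have n2b: "AE x in M. \<bar>n2 x\<bar> \<le> \<delta>"
    proof eventually_elim
      fix x assume "ereal \<bar>n2 x\<bar> \<le> Linf_norm M n2"
      also note lt
      finally show "\<bar>n2 x\<bar> \<le> \<delta>" by simp
    qed
    have "X_op_norm D (\<lambda>u x. B_op D \<eta> n1 n2 k u x - B_op D \<eta> n1 (\<lambda>_. 0) k u x) \<le> ereal (\<epsilon> / 2)"
      unfolding X_op_norm_def
    proof (rule SUP_least)
      fix u assume "u \<in> {u \<in> X_space D. H2_norm D u \<le> 1}"
      then have u: "u \<in> X_space D" and u1: "H2_norm D u \<le> 1" by auto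
      have "H2_norm D (\<lambda>x. B_op D \<eta> n1 n2 k u x - B_op D \<eta> n1 (\<lambda>_. 0) k u x)
          \<le> \<delta> / (Re k * c)\<^sup>2 * A * H2_norm D u"
        unfolding A_def using assms(6,12) n2 n2b \<delta> c(1) c' u
        by (intro B_op_diff_norm_le) (simp_all add: Linf_def)
      also have "\<dots> \<le> \<delta> / (Re k * c)\<^sup>2 * A * 1"
        using u1 \<delta> A by (intro mult_left_mono) simp_all
      also have "\<dots> \<le> \<epsilon> / 2" using small by simp
      finally show "ereal (H2_norm D (\<lambda>x. B_op D \<eta> n1 n2 k u x - B_op D \<eta> n1 (\<lambda>_. 0) k u x)) \<le> ereal (\<epsilon> / 2)"
        by simp
    qed
    also have "\<dots> < ereal \<epsilon>" using \<epsilon> by simp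
    finally show "X_op_norm D (\<lambda>u x. B_op D \<eta> n1 n2 k u x - B_op D \<eta> n1 (\<lambda>_. 0) k u x) < ereal \<epsilon>" .
  qed (rule \<delta>)
qed

end
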